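(* The halting problem of a quasiminimal $\Pi^0_1$ subshift $X \subset S^{\mathbb{Z}}$ ($S$ a finite alphabet) is decidable.
   Context: A subshift is a closed (product topology) set $X \subset S^{\mathbb{Z}}$ with $\sigma(X)=X$, where $\sigma(x)_i=x_{i+1}$; it is quasiminimal if it contains only finitely many proper subshifts. The language $\mathcal{L}(X) \subset S^*$ is the set of finite words occurring as contiguous subwords of points of $X$; $X$ is $\Pi^0_1$ if $S^*\setminus \mathcal{L}(X)$ is recursively enumerable. For a finite set $C$ of words of a common length $n$, $[C]$ is the clopen set of points $x$ with $x_{[0,n-1]} \in C$; clopen sets are given in such a finite form (up to a shift of coordinates). The halting problem of $X$ is: given clopen sets $[C],[D]$, decide whether there exist $x \in X$ and $j \in \mathbb{N}=\{0,1,2,\dots\}$ with $x \in [C]$ and $\sigma^j(x) \in [D]$. The subshift $X$ is fixed. *)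

theory Defs
  imports
    "HOL-Analysis.Function_Topology"
    "HOL-Library.Countable"
    "HOL-Library.Nat_Bijection"
begin

section \<open>Partial recursive functions\<close>

text \<open>
  Programs for Kleene's partial recursive functions. In \<open>PrimRec f g\<close> the recursion is on
  the first argument, \<open>g\<close> receiving the predecessor and the previous value as its first two
  arguments; \<open>Mu f\<close> minimises over the first argument of \<open>f\<close>. Arities are not part of the
  syntax; \<open>Zero\<close> is the constant function of every arity.
\<close>

datatype recf =
    Zero
  | Succ
  | Proj nat
  | Comp recf "recf list"
  | PrimRec recf recf
  | Mu recf

inductive computes :: "recf \<Rightarrow> nat list \<Rightarrow> nat \<Rightarrow> bool" where
  Zero: "computes Zero xs 0"
| Succ: "computes Succ [x] (Suc x)"
| Proj: "i < length xs \<Longrightarrow> computes (Proj i) xs (xs ! i)"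
| Comp: "list_all2 (\<lambda>g y. computes g xs y) gs ys \<Longrightarrow> computes f ys z \<Longrightarrow>
           computes (Comp f gs) xs z"
| PrimRec_0: "computes f xs y \<Longrightarrow> computes (PrimRec f g) (0 # xs) y"
| PrimRec_Suc: "computes (PrimRec f g) (n # xs) y \<Longrightarrow> computes g (n # y # xs) z \<Longrightarrow>
           computes (PrimRec f g) (Suc n # xs) z"
| Mu: "computes f (n # xs) 0 \<Longrightarrow> (\<forall>m<n. \<exists>y>0. computes f (m # xs) y) \<Longrightarrow>
           computes (Mu f) xs n"

inductive_cases computes_ZeroE: "computes Zero xs z"
inductive_cases computes_SuccE: "computes Succ xs z"
inductive_cases computes_ProjE: "computes (Proj i) xs z"
inductive_cases computes_CompE: "computes (Comp f gs) xs z"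
inductive_cases computes_PrimRec_0E: "computes (PrimRec f g) (0 # xs) z"
inductive_cases computes_PrimRec_SucE: "computes (PrimRec f g) (Suc n # xs) z"
inductive_cases computes_MuE: "computes (Mu f) xs z"

lemma computes_deterministic:
  "computes f xs y \<Longrightarrow> computes f xs z \<Longrightarrow> y = z"
proof (induction arbitrary: z rule: computes.induct)
  case (Zero xs)
  then show ?case by (rule computes_ZeroE) simp
next
  case (Succ x)
  then show ?case by (rule computes_SuccE) simp
next
  case (Proj i xs)
  from Proj(2) show ?case by (rule computes_ProjE) simp
next
  case (Comp xs gs ys f y)
  from Comp.prems obtain ys' where ys': "list_all2 (\<lambda>g y. computes g xs y) gs ys'"
    and z: "computes f ys' z"
    by (rule computes_CompE)
  have "ys = ys'"
    using Comp.IH(1) ys' by (auto simp: list_all2_conv_all_nth intro!: nth_equalityI)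
  with Comp.IH(2) z show ?case by blast
next
  case (PrimRec_0 f xs y g)
  from PrimRec_0.prems show ?case by (rule computes_PrimRec_0E) (rule PrimRec_0.IH)
next
  case (PrimRec_Suc f g n xs y y')
  from PrimRec_Suc.prems obtain u where "computes (PrimRec f g) (n # xs) u"
    and "computes g (n # u # xs) z"
    by (rule computes_PrimRec_SucE)
  with PrimRec_Suc.IH show ?case by blast
next
  case (Mu f n xs)
  from Mu.prems have z: "computes f (z # xs) 0" "\<forall>m<z. \<exists>y>0. computes f (m # xs) y"
    by (rule computes_MuE, blast)+
  have "\<not> z < n"
    using Mu.IH(2) z(1) by blast
  moreover have "\<not> n < z"
    using Mu.IH(1) z(2) by blast
  ultimately show ?case by simp
qed

definition decidable :: "nat set \<Rightarrow> bool" where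
  "decidable A \<longleftrightarrow> (\<exists>f. \<forall>n. computes f [n] (if n \<in> A then 1 else 0))"

definition recursively_enumerable :: "nat set \<Rightarrow> bool" where
  "recursively_enumerable A \<longleftrightarrow> (\<exists>f. \<forall>n. n \<in> A \<longleftrightarrow> (\<exists>y. computes f [n] y))"


section \<open>Subshifts\<close>

definition shift_map :: "(int \<Rightarrow> 'a) \<Rightarrow> (int \<Rightarrow> 'a)" where
  "shift_map x = (\<lambda>i. x (i + 1))"

definition subshift :: "(int \<Rightarrow> 'a) set \<Rightarrow> bool" where
  "subshift X \<longleftrightarrow>
     closedin (product_topology (\<lambda>_. discrete_topology UNIV) UNIV) X \<and> shift_map ` X = X"

definition quasiminimal :: "(int \<Rightarrow> 'a) set \<Rightarrow> bool" where
  "quasiminimal X \<longleftrightarrow> finite {Y. subshift Y \<and> Y \<subset> X}"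

definition subword :: "(int \<Rightarrow> 'a) \<Rightarrow> int \<Rightarrow> nat \<Rightarrow> 'a list" where
  "subword x i n = map (\<lambda>k. x (i + int k)) [0..<n]"

definition language :: "(int \<Rightarrow> 'a) set \<Rightarrow> 'a list set" where
  "language X = {subword x i n | x i n. x \<in> X}"

text \<open>
  On the alphabet, \<^const>\<open>to_nat\<close> is an unspecified injection; as the alphabet is finite, any two
  such injections differ by a computable renaming, so the choice does not affect computability.
\<close>

definition word_code :: "'a::finite list \<Rightarrow> nat" where
  "word_code w = list_encode (map to_nat w)"

definition Pi01 :: "(int \<Rightarrow> 'a::finite) set \<Rightarrow> bool" where
  "Pi01 X \<longleftrightarrow> recursively_enumerable (word_code ` (- language X))"


section \<open>The halting problem\<close>

text \<open>
  A clopen set is presented by a position \<open>a\<close> and a finite list \<open>C\<close> of words of a common length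
  \<open>n\<close>, and consists of the points \<open>x\<close> whose subword on the window \<open>[a, a + n - 1]\<close> belongs to \<open>C\<close>.
  Position 0 gives \<open>[C]\<close>; other positions are its translates under the shift.
\<close>

definition common_length :: "'a list list \<Rightarrow> bool" where
  "common_length C \<longleftrightarrow> (\<exists>n. \<forall>w\<in>set C. length w = n)"

definition clopen :: "int \<Rightarrow> 'a list list \<Rightarrow> (int \<Rightarrow> 'a) set" where
  "clopen a C = {x. \<exists>w\<in>set C. subword x a (length w) = w}"

definition clopen_code :: "int \<Rightarrow> 'a::finite list list \<Rightarrow> nat" where
  "clopen_code a C = prod_encode (int_encode a, list_encode (map word_code C))"

definition halts :: "(int \<Rightarrow> 'a) set \<Rightarrow> (int \<Rightarrow> 'a) set \<Rightarrow> (int \<Rightarrow> 'a) set \<Rightarrow> bool" where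
  "halts X U V \<longleftrightarrow> (\<exists>x\<in>X. \<exists>j::nat. x \<in> U \<and> (shift_map ^^ j) x \<in> V)"

definition halting_problem :: "(int \<Rightarrow> 'a::finite) set \<Rightarrow> nat set" where
  "halting_problem X =
     {prod_encode (clopen_code a C, clopen_code b D) | a C b D.
        common_length C \<and> common_length D \<and> halts X (clopen a C) (clopen b D)}"

lemma inj_word_code: "inj word_code"
  by (auto simp: word_code_def inj_def list_encode_eq inj_map_eq_map)

lemma clopen_code_eq_iff [simp]: "clopen_code a C = clopen_code b D \<longleftrightarrow> a = b \<and> C = D"
  by (simp add: clopen_code_def list_encode_eq inj_map_eq_map inj_word_code int_encode_eq)

lemma halting_problem_iff:
  "prod_encode (clopen_code a C, clopen_code b D) \<in> halting_problem X \<longleftrightarrow>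
     common_length C \<and> common_length D \<and> halts X (clopen a C) (clopen b D)"
  by (auto simp: halting_problem_def)

end

theory Submission
  imports Defs
begin

text \<open>
  Let \<open>X\<close> be quasiminimal. Every point \<open>x\<close> of \<open>X\<close> lies in its own orbit closure, and the orbit
  closures are among the finitely many subsystems of \<open>X\<close>; so \<open>X\<close> halts from \<open>U\<close> to \<open>V\<close> iff one of
  finitely many orbit closures does, and it is enough to treat one \<open>Z\<close>, the orbit closure of \<open>x\<close>.
  For such a \<open>Z\<close> both halting and its negation are shown to be semidecidable. The resulting
  algorithm depends on a finite amount of information about \<open>X\<close> that exists but is not computed.

  Quasiminimality enters by way of finitely many patterns. If \<open>A\<close> is a subshift, then each of the
  finitely many subsystems of \<open>X\<close> not contained in \<open>A\<close> has a pattern foreign to \<open>A\<close>; hence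
  a point of \<open>X\<close> belongs to \<open>A\<close> iff none of these finitely many patterns occurs in it
  (\<open>separating_patterns\<close>). In particular \<open>y \<notin> Z\<close> is semidecidable in \<open>y\<close>, as \<open>y \<notin> X\<close> is. In the same
  way, \<open>x\<close> has a neighbourhood in which all points of \<open>Z\<close> have orbit closure \<open>Z\<close>
  (\<open>generic_neighbourhood\<close>).

  Halting in \<open>Z\<close> says that \<open>U\<close> intersected with the preimage of \<open>V\<close> under some \<open>n\<close>-fold shift meets
  \<open>Z\<close>. This open set meets \<open>Z\<close> iff every point in the neighbourhood of \<open>x\<close> just mentioned either
  lies outside \<open>Z\<close> or visits it along its orbit. All of this is an open condition on a point, and by compactness
  ``every point satisfies the open condition'' is again semidecidable (\<open>semidecidable_all\<close>).

  Non-halting concerns all \<open>n\<close> at once, which no compactness argument covers directly. The orbit of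
  \<open>x\<close> is dense in \<open>Z\<close>, so halting in \<open>Z\<close> means that \<open>x\<close> visits \<open>U\<close> and, no earlier, \<open>V\<close>. If there is
  no halting although \<open>Z\<close> meets \<open>U\<close> and \<open>V\<close>, then \<open>x\<close> cannot visit \<open>U\<close> arbitrarily far to the left
  nor \<open>V\<close> arbitrarily far to the right: \<open>U\<close> avoids the \<open>\<alpha>\<close>-limit set of \<open>x\<close>, and \<open>V\<close> avoids its
  \<open>\<omega>\<close>-limit set. Thus every point of \<open>Z\<close> in \<open>U\<close> contains one of the patterns that separate the
  \<open>\<alpha>\<close>-limit set, and it does so within a distance \<open>N\<close> that compactness makes uniform and a search
  finds. Those patterns do not occur in \<open>x\<close> to the left of a fixed position, so \<open>N\<close> bounds the
  visits of \<open>x\<close> to \<open>U\<close> from the left. With the same bound for \<open>V\<close> from the right, only finitely many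
  \<open>n\<close> remain to be excluded, each by compactness (\<open>not_halts_orbit_closure_iff\<close>).

  On the computability side, all this is expressed with one class of relations between a number and
  a configuration, \<open>semidecidable\<close>, which is closed under conjunction, disjunction, existential and
  bounded universal quantification over numbers, and universal quantification over configurations.
  The graph of each partial recursive function belongs to this class by structural induction
  (\<open>semidecidable_computes\<close>); this is how the recursive enumerability of the complement of the
  language makes \<open>y \<notin> X\<close> semidecidable (\<open>semidecidable_notin_Pi01\<close>).
\<close>

section \<open>Total computable functions\<close>

text \<open>
  Programs carry no arity; fixing the length of the argument list supplies it.
\<close>

definition total_recursive :: "nat \<Rightarrow> (nat list \<Rightarrow> nat) \<Rightarrow> bool" where
  "total_recursive k h \<longleftrightarrow> (\<exists>f. \<forall>xs. length xs = k \<longrightarrow> computes f xs (h xs))"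

text \<open>
  Functions of several arguments are treated as unary functions of a packed environment, unpacked
  with \<open>pfst\<close> and \<open>psnd\<close> below. Every closure rule then has the form of an introduction rule that is
  selected by the outermost operation in the body of the function.
\<close>

definition computable :: "(nat \<Rightarrow> nat) \<Rightarrow> bool" where
  "computable h \<longleftrightarrow> total_recursive 1 (\<lambda>xs. h (xs ! 0))"

lemma total_recursive_comp1:
  assumes f: "total_recursive 1 (\<lambda>xs. f (xs ! 0))" and a: "total_recursive k a"
  shows "total_recursive k (\<lambda>xs. f (a xs))"
proof -
  obtain F where F: "\<And>xs. length xs = 1 \<Longrightarrow> computes F xs (f (xs ! 0))"
    using f unfolding total_recursive_def by blast
  obtain G where G: "\<And>xs. length xs = k \<Longrightarrow> computes G xs (a xs)"
    using a unfolding total_recursive_def by blast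
  have "computes (Comp F [G]) xs (f (a xs))" if "length xs = k" for xs
    using F[of "[a xs]"] G[OF that] by (intro computes.Comp[where ys = "[a xs]"]) auto
  then show ?thesis unfolding total_recursive_def by blast
qed

lemma total_recursive_comp2:
  assumes f: "total_recursive 2 (\<lambda>xs. f (xs ! 0) (xs ! 1))"
    and a: "total_recursive k a" and b: "total_recursive k b"
  shows "total_recursive k (\<lambda>xs. f (a xs) (b xs))"
proof -
  obtain F where F: "\<And>xs. length xs = 2 \<Longrightarrow> computes F xs (f (xs ! 0) (xs ! 1))"
    using f unfolding total_recursive_def by blast
  obtain G where G: "\<And>xs. length xs = k \<Longrightarrow> computes G xs (a xs)"
    using a unfolding total_recursive_def by blast
  obtain H where H: "\<And>xs. length xs = k \<Longrightarrow> computes H xs (b xs)"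
    using b unfolding total_recursive_def by blast
  have "computes (Comp F [G, H]) xs (f (a xs) (b xs))" if "length xs = k" for xs
    using F[of "[a xs, b xs]"] G[OF that] H[OF that]
    by (intro computes.Comp[where ys = "[a xs, b xs]"]) auto
  then show ?thesis unfolding total_recursive_def by blast
qed

lemma total_recursive_nth: "i < k \<Longrightarrow> total_recursive k (\<lambda>xs. xs ! i)"
  unfolding total_recursive_def using computes.Proj by blast

lemma total_recursive_Suc: "total_recursive 1 (\<lambda>xs. Suc (xs ! 0))"
proof -
  have "computes Succ xs (Suc (xs ! 0))" if "length xs = 1" for xs
    using that computes.Succ[of "xs ! 0"] by (cases xs) auto
  then show ?thesis unfolding total_recursive_def by blast
qed

lemma total_recursive_const: "total_recursive k (\<lambda>_. c)"
proof (induction c)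
  case 0
  show ?case unfolding total_recursive_def using computes.Zero by blast
next
  case (Suc c)
  show ?case by (rule total_recursive_comp1[OF total_recursive_Suc Suc])
qed

text \<open>
  A single parameter \<open>e\<close> is enough, since pairing will allow it to hold any number of values.
\<close>

lemma total_recursive_rec:
  assumes a: "total_recursive 1 (\<lambda>xs. a (xs ! 0))"
    and g: "total_recursive 3 (\<lambda>xs. g (xs ! 0) (xs ! 1) (xs ! 2))"
  shows "total_recursive 2 (\<lambda>xs. rec_nat (a (xs ! 1)) (\<lambda>k y. g k y (xs ! 1)) (xs ! 0))"
proof -
  obtain F where F: "\<And>xs. length xs = 1 \<Longrightarrow> computes F xs (a (xs ! 0))"
    using a unfolding total_recursive_def by blast
  obtain G where G: "\<And>xs. length xs = 3 \<Longrightarrow> computes G xs (g (xs ! 0) (xs ! 1) (xs ! 2))"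
    using g unfolding total_recursive_def by blast
  have "computes (PrimRec F G) [n, e] (rec_nat (a e) (\<lambda>k y. g k y e) n)" for n e
  proof (induction n)
    case 0
    show ?case using F[of "[e]"] by (auto intro: computes.PrimRec_0)
  next
    case (Suc n)
    show ?case
      using computes.PrimRec_Suc[OF Suc, of "g n (rec_nat (a e) (\<lambda>k y. g k y e) n) e"]
        G[of "[n, rec_nat (a e) (\<lambda>k y. g k y e) n, e]"] by (simp add: numeral_2_eq_2)
  qed
  then have "computes (PrimRec F G) xs (rec_nat (a (xs ! 1)) (\<lambda>k y. g k y (xs ! 1)) (xs ! 0))"
    if "length xs = 2" for xs
    using that by (auto simp: numeral_2_eq_2 length_Suc_conv)
  then show ?thesis unfolding total_recursive_def by blast
qed

lemma total_recursive_Least: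
  assumes f: "total_recursive 2 (\<lambda>xs. f (xs ! 0) (xs ! 1))" and ex: "\<And>e. \<exists>n. f n e = 0"
  shows "total_recursive 1 (\<lambda>xs. LEAST n. f n (xs ! 0) = 0)"
proof -
  obtain F where F: "\<And>xs. length xs = 2 \<Longrightarrow> computes F xs (f (xs ! 0) (xs ! 1))"
    using f unfolding total_recursive_def by blast
  have "computes (Mu F) [e] (LEAST n. f n e = 0)" for e
  proof (rule computes.Mu)
    have "f (LEAST n. f n e = 0) e = 0"
      using LeastI_ex[OF ex] .
    then show "computes F [LEAST n. f n e = 0, e] 0"
      using F[of "[LEAST n. f n e = 0, e]"] by simp
    show "\<forall>m<LEAST n. f n e = 0. \<exists>y>0. computes F [m, e] y"
      using F[of "[_, e]"] not_less_Least by fastforce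
  qed
  then have "computes (Mu F) xs (LEAST n. f n (xs ! 0) = 0)" if "length xs = 1" for xs
    using that by (cases xs) auto
  then show ?thesis unfolding total_recursive_def by blast
qed

lemma total_recursive_add: "total_recursive 2 (\<lambda>xs. xs ! 0 + xs ! 1)"
proof -
  have "rec_nat e (\<lambda>k. Suc) n = n + e" for n e
    by (induction n) auto
  with total_recursive_rec[of "\<lambda>e. e" "\<lambda>k y e. Suc y"] show ?thesis
    by (simp add: total_recursive_nth total_recursive_comp1[OF total_recursive_Suc])
qed

lemma total_recursive_mult: "total_recursive 2 (\<lambda>xs. xs ! 0 * xs ! 1)"
proof -
  have "rec_nat 0 (\<lambda>k y. y + e) n = n * e" for n e :: nat
    by (induction n) auto
  with total_recursive_rec[of "\<lambda>e. 0" "\<lambda>k y e. y + e"] show ?thesis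
    by (simp add: total_recursive_nth total_recursive_const
        total_recursive_comp2[OF total_recursive_add])
qed

lemma total_recursive_pred: "total_recursive 1 (\<lambda>xs. xs ! 0 - 1)"
proof -
  have "rec_nat 0 (\<lambda>k y. k) n = n - 1" for n :: nat
    by (cases n) auto
  with total_recursive_rec[of "\<lambda>e. 0" "\<lambda>k y e. k"]
  have "total_recursive 2 (\<lambda>xs. xs ! 0 - 1)"
    by (simp add: total_recursive_nth total_recursive_const)
  then show ?thesis
    using total_recursive_comp2[of "\<lambda>x y. x - 1" 1 "\<lambda>xs. xs ! 0" "\<lambda>xs. xs ! 0"]
    by (simp add: total_recursive_nth)
qed

lemma total_recursive_diff: "total_recursive 2 (\<lambda>xs. xs ! 0 - xs ! 1)"
proof -
  have "rec_nat e (\<lambda>k y. y - 1) n = e - n" for n e :: nat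
    by (induction n) auto
  with total_recursive_rec[of "\<lambda>e. e" "\<lambda>k y e. y - 1"]
  have "total_recursive 2 (\<lambda>xs. xs ! 1 - xs ! 0)"
    using total_recursive_comp1[OF total_recursive_pred, of 3 "\<lambda>xs. xs ! 1"]
    by (simp add: total_recursive_nth)
  from total_recursive_comp2[OF this, of 2 "\<lambda>xs. xs ! 1" "\<lambda>xs. xs ! 0"] show ?thesis
    by (simp add: total_recursive_nth)
qed

lemma total_recursive_triangle: "total_recursive 1 (\<lambda>xs. triangle (xs ! 0))"
proof -
  have "rec_nat 0 (\<lambda>k y. y + Suc k) n = triangle n" for n
    by (induction n) auto
  with total_recursive_rec[of "\<lambda>e. 0" "\<lambda>k y e. y + Suc k"]
  have "total_recursive 2 (\<lambda>xs. triangle (xs ! 0))"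
    using total_recursive_comp2[OF total_recursive_add, of 3 "\<lambda>xs. xs ! 1" "\<lambda>xs. Suc (xs ! 0)"]
    by (simp add: total_recursive_nth total_recursive_const
        total_recursive_comp1[OF total_recursive_Suc])
  then show ?thesis
    using total_recursive_comp2[of "\<lambda>x y. triangle x" 1 "\<lambda>xs. xs ! 0" "\<lambda>xs. xs ! 0"]
    by (simp add: total_recursive_nth)
qed

lemma total_recursive_pair: "total_recursive 2 (\<lambda>xs. prod_encode (xs ! 0, xs ! 1))"
  unfolding prod_encode_def prod.case
  by (intro total_recursive_comp2[OF total_recursive_add]
      total_recursive_comp1[OF total_recursive_triangle] total_recursive_nth) simp_all

lemma computable_id: "computable (\<lambda>e. e)"
  unfolding computable_def by (simp add: total_recursive_nth)

lemma computable_const: "computable (\<lambda>_. c)"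
  unfolding computable_def by (rule total_recursive_const)

lemma computable_comp:
  "computable f \<Longrightarrow> computable a \<Longrightarrow> computable (\<lambda>e. f (a e))"
  unfolding computable_def by (rule total_recursive_comp1)

lemma computable_comp2:
  "total_recursive 2 (\<lambda>xs. f (xs ! 0) (xs ! 1)) \<Longrightarrow> computable a \<Longrightarrow> computable b \<Longrightarrow>
    computable (\<lambda>e. f (a e) (b e))"
  unfolding computable_def by (rule total_recursive_comp2)

lemma computable_Suc: "computable a \<Longrightarrow> computable (\<lambda>e. Suc (a e))"
  unfolding computable_def by (rule total_recursive_comp1[OF total_recursive_Suc])

lemmas computable_add = computable_comp2[OF total_recursive_add]
lemmas computable_mult = computable_comp2[OF total_recursive_mult]
lemmas computable_diff = computable_comp2[OF total_recursive_diff]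
lemmas computable_pair = computable_comp2[OF total_recursive_pair]

definition pfst :: "nat \<Rightarrow> nat" where "pfst n = fst (prod_decode n)"
definition psnd :: "nat \<Rightarrow> nat" where "psnd n = snd (prod_decode n)"

lemma pfst_pair [simp]: "pfst (prod_encode (a, b)) = a"
  and psnd_pair [simp]: "psnd (prod_encode (a, b)) = b"
  and pair_pfst_psnd [simp]: "prod_encode (pfst n, psnd n) = n"
  by (simp_all add: pfst_def psnd_def)

lemma pfst_0 [simp]: "pfst 0 = 0" and psnd_0 [simp]: "psnd 0 = 0"
  using pfst_pair[of 0 0] psnd_pair[of 0 0] by (simp_all add: prod_encode_def)

lemma triangle_mono: "i \<le> j \<Longrightarrow> triangle i \<le> triangle j"
  by (rule lift_Suc_mono_le) simp_all

text \<open>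
  The pairing function runs through \<open>\<nat> \<times> \<nat>\<close> along the diagonals of constant sum, the first pair on
  diagonal \<open>d\<close> having code \<open>triangle d\<close>. So the diagonal of a code is found by minimisation, which gives
  the inverse of pairing.
\<close>

definition diagonal :: "nat \<Rightarrow> nat" where
  "diagonal n = (LEAST d. Suc n - triangle (Suc d) = 0)"

lemma diagonal_eq: "diagonal n = pfst n + psnd n"
proof -
  let ?a = "pfst n" and ?b = "psnd n"
  have n: "n = triangle (?a + ?b) + ?a"
    using pair_pfst_psnd[of n] by (simp only: prod_encode_def prod.case)
  show ?thesis
    unfolding diagonal_def
  proof (rule Least_equality)
    show "Suc n - triangle (Suc (?a + ?b)) = 0"
      using n by (simp del: pair_pfst_psnd)
  next
    fix d assume "Suc n - triangle (Suc d) = 0"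
    then have "triangle (?a + ?b) < triangle (Suc d)"
      using n by linarith
    then show "?a + ?b \<le> d"
      using triangle_mono[of "Suc d" "?a + ?b"] by linarith
  qed
qed

lemma computable_diagonal: "computable diagonal"
proof -
  have "total_recursive 2 (\<lambda>xs. Suc (xs ! 1) - triangle (Suc (xs ! 0)))"
    by (intro total_recursive_comp2[OF total_recursive_diff]
        total_recursive_comp1[OF total_recursive_Suc]
        total_recursive_comp1[OF total_recursive_triangle] total_recursive_nth) simp_all
  moreover have "\<exists>n. Suc e - triangle (Suc n) = 0" for e
    by (intro exI[of _ e]) simp
  ultimately show ?thesis
    using total_recursive_Least[of "\<lambda>d n. Suc n - triangle (Suc d)"]
    by (simp add: computable_def diagonal_def)
qed

lemma computable_pfst: "computable a \<Longrightarrow> computable (\<lambda>e. pfst (a e))"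
proof -
  have "pfst n = n - triangle (diagonal n)" for n
    using pair_pfst_psnd[of n] unfolding diagonal_eq prod_encode_def by simp
  moreover have "computable (\<lambda>n. n - triangle (diagonal n))"
    using computable_diff[OF computable_id computable_comp[OF _ computable_diagonal]]
      total_recursive_triangle by (simp add: computable_def)
  ultimately have "computable pfst"
    by presburger
  then show "computable a \<Longrightarrow> computable (\<lambda>e. pfst (a e))"
    by (rule computable_comp)
qed

lemma computable_psnd: "computable a \<Longrightarrow> computable (\<lambda>e. psnd (a e))"
proof -
  have "computable (\<lambda>n. diagonal n - pfst n)"
    by (rule computable_diff[OF computable_diagonal computable_pfst[OF computable_id]])
  then have "computable psnd"
    by (simp add: diagonal_eq)
  then show "computable a \<Longrightarrow> computable (\<lambda>e. psnd (a e))"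
    by (rule computable_comp)
qed

lemma computable_rec:
  assumes a: "computable a" and g: "computable (\<lambda>p. g (pfst p) (pfst (psnd p)) (psnd (psnd p)))"
    and n: "computable n"
  shows "computable (\<lambda>e. rec_nat (a e) (\<lambda>k y. g k y e) (n e))"
proof -
  have "total_recursive 3 (\<lambda>xs. prod_encode (xs ! 0, prod_encode (xs ! 1, xs ! 2)))"
    by (intro total_recursive_comp2[OF total_recursive_pair] total_recursive_nth) simp_all
  from total_recursive_comp1[OF g[unfolded computable_def] this]
  have "total_recursive 3 (\<lambda>xs. g (xs ! 0) (xs ! 1) (xs ! 2))"
    by simp
  from total_recursive_rec[OF a[unfolded computable_def] this]
  show ?thesis
    using computable_comp2[of "\<lambda>n e. rec_nat (a e) (\<lambda>k y. g k y e) n", OF _ n computable_id]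
    by simp
qed

section \<open>Decidable predicates\<close>

definition decidable_pred :: "(nat \<Rightarrow> bool) \<Rightarrow> bool" where
  "decidable_pred P \<longleftrightarrow> computable (\<lambda>e. of_bool (P e))"

lemma decidable_pred_subst:
  "decidable_pred P \<Longrightarrow> computable a \<Longrightarrow> decidable_pred (\<lambda>e. P (a e))"
  unfolding decidable_pred_def by (rule computable_comp)

lemma decidable_pred_const: "decidable_pred (\<lambda>_. b)"
  unfolding decidable_pred_def by (rule computable_const)

lemma decidable_pred_not: "decidable_pred P \<Longrightarrow> decidable_pred (\<lambda>e. \<not> P e)"
proof -
  assume "decidable_pred P"
  then have "computable (\<lambda>e. 1 - of_bool (P e))"
    unfolding decidable_pred_def by (rule computable_diff[OF computable_const])
  moreover have "of_bool (\<not> b) = (1 - of_bool b :: nat)" for b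
    by simp
  ultimately show "decidable_pred (\<lambda>e. \<not> P e)"
    by (simp only: decidable_pred_def)
qed

lemma decidable_pred_conj:
  "decidable_pred P \<Longrightarrow> decidable_pred Q \<Longrightarrow> decidable_pred (\<lambda>e. P e \<and> Q e)"
  unfolding decidable_pred_def of_bool_conj by (rule computable_mult)

lemma decidable_pred_disj:
  assumes "decidable_pred P" "decidable_pred Q"
  shows "decidable_pred (\<lambda>e. P e \<or> Q e)"
  using decidable_pred_not[OF decidable_pred_conj[OF assms[THEN decidable_pred_not]]] by simp

lemma decidable_pred_imp:
  assumes "decidable_pred P" "decidable_pred Q"
  shows "decidable_pred (\<lambda>e. P e \<longrightarrow> Q e)"
  using decidable_pred_disj[OF decidable_pred_not[OF assms(1)] assms(2)] by (simp only: imp_conv_disj)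

lemma decidable_pred_less:
  assumes "computable a" "computable b"
  shows "decidable_pred (\<lambda>e. a e < b e)"
proof -
  have "of_bool (a e < b e) = 1 - (1 - (b e - a e))" for e
    by simp
  moreover have "computable (\<lambda>e. 1 - (1 - (b e - a e)))"
    by (intro computable_diff computable_const assms)
  ultimately show ?thesis
    unfolding decidable_pred_def by simp
qed

lemma decidable_pred_le:
  "computable a \<Longrightarrow> computable b \<Longrightarrow> decidable_pred (\<lambda>e. a e \<le> b e)"
  using decidable_pred_not[OF decidable_pred_less[of b a]] by (simp only: not_less)

lemma decidable_pred_eq:
  assumes "computable a" "computable b"
  shows "decidable_pred (\<lambda>e. a e = b e)"
  using decidable_pred_conj[OF decidable_pred_le decidable_pred_le, OF assms assms(2,1)]
  by (simp only: order_eq_iff)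

text \<open>
  Recursion counts the witnesses below the bound.
\<close>

lemma decidable_pred_bex:
  assumes P: "decidable_pred (\<lambda>p. P (pfst p) (psnd p))" and b: "computable b"
  shows "decidable_pred (\<lambda>e. \<exists>i<b e. P i e)"
proof -
  have "(0 < rec_nat (0::nat) (\<lambda>k y. y + of_bool (P k e)) n) = (\<exists>i<n. P i e)" for n e
    by (induction n) (auto simp: less_Suc_eq)
  moreover have "decidable_pred (\<lambda>e. 0 < rec_nat (0::nat) (\<lambda>k y. y + of_bool (P k e)) (b e))"
  proof (intro decidable_pred_less computable_const computable_rec computable_add b)
    have "decidable_pred (\<lambda>p. P (pfst p) (psnd (psnd p)))"
      using decidable_pred_subst[OF P, of "\<lambda>p. prod_encode (pfst p, psnd (psnd p))"]
      by (simp add: computable_pair computable_pfst computable_psnd computable_id)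
    then show "computable (\<lambda>p. of_bool (P (pfst p) (psnd (psnd p))))"
      by (simp add: decidable_pred_def)
  qed (intro computable_pfst computable_psnd computable_id)
  ultimately show ?thesis
    by simp
qed

lemma decidable_pred_ball:
  assumes P: "decidable_pred (\<lambda>p. P (pfst p) (psnd p))" and b: "computable b"
  shows "decidable_pred (\<lambda>e. \<forall>i<b e. P i e)"
  using decidable_pred_not[OF decidable_pred_bex[of "\<lambda>i e. \<not> P i e", OF decidable_pred_not[OF P] b]] by simp

lemma decidable_pred_finite:
  assumes "finite S" and a: "computable a"
  shows "decidable_pred (\<lambda>e. a e \<in> S)"
  using assms(1)
proof induction
  case empty
  show ?case by (simp add: decidable_pred_const)
next
  case (insert c S)
  then show ?case
    using decidable_pred_disj[OF decidable_pred_eq[OF a computable_const, of c]] by simp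
qed

lemma computable_if:
  assumes P: "decidable_pred P" and a: "computable a" and b: "computable b"
  shows "computable (\<lambda>e. if P e then a e else b e)"
proof -
  have "(if P e then a e else b e) = of_bool (P e) * a e + of_bool (\<not> P e) * b e" for e
    by simp
  moreover have "computable (\<lambda>e. of_bool (P e) * a e + of_bool (\<not> P e) * b e)"
    using P decidable_pred_not[OF P] unfolding decidable_pred_def
    by (intro computable_add computable_mult a b)
  ultimately show ?thesis by presburger
qed

lemma computable_Least:
  assumes P: "decidable_pred (\<lambda>p. P (pfst p) (psnd p))" and ex: "\<And>e. \<exists>n. P n e"
  shows "computable (\<lambda>e. LEAST n. P n e)"
proof -
  have "total_recursive 2 (\<lambda>xs. of_bool (\<not> P (xs ! 0) (xs ! 1)))"
    using total_recursive_comp1[OF decidable_pred_not[OF P, unfolded decidable_pred_def computable_def] total_recursive_pair]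
    by simp
  from total_recursive_Least[of "\<lambda>n e. of_bool (\<not> P n e)", OF this] ex
  show ?thesis by (simp add: computable_def)
qed

lemma computable_half: "computable a \<Longrightarrow> computable (\<lambda>e. a e div 2)"
proof -
  have "n div 2 = (LEAST d. n < 2 * d + 2)" for n :: nat
    by (rule Least_equality[symmetric]) auto
  moreover have "computable (\<lambda>n. LEAST d. n < 2 * d + 2)"
  proof (rule computable_Least)
    show "decidable_pred (\<lambda>p. psnd p < 2 * pfst p + 2)"
      by (intro decidable_pred_less computable_add computable_mult computable_const computable_psnd
          computable_pfst computable_id)
    show "\<exists>d. n < 2 * d + 2" for n :: nat
      by (intro exI[of _ n]) simp
  qed
  ultimately have "computable (\<lambda>n. n div 2)"
    by presburger
  then show "computable a \<Longrightarrow> computable (\<lambda>e. a e div 2)"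
    by (rule computable_comp)
qed

lemma decidable_pred_even: "computable a \<Longrightarrow> decidable_pred (\<lambda>e. even (a e))"
proof -
  assume a: "computable a"
  have "decidable_pred (\<lambda>e. 2 * (a e div 2) = a e)"
    by (intro decidable_pred_eq computable_mult computable_half computable_const a)
  moreover have "(2 * (n div 2) = n) = even n" for n :: nat
    by presburger
  ultimately show ?thesis by simp
qed

section \<open>Arithmetic on codes of integers and lists\<close>

text \<open>
  Positions in a configuration are integers and enter computations through \<^const>\<open>int_encode\<close>.
\<close>

definition int_code_add :: "nat \<Rightarrow> nat \<Rightarrow> nat" where
  "int_code_add p q = int_encode (int_decode p + int_decode q)"

lemma int_decode_add [simp]: "int_decode (int_code_add p q) = int_decode p + int_decode q"
  by (simp add: int_code_add_def)

lemma abs_int_decode_le: "\<bar>int_decode n\<bar> \<le> int n"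
  by (auto simp: int_decode_def sum_decode_def) presburger

lemma ex_int_decode: "(\<exists>i. P i) \<longleftrightarrow> (\<exists>n. P (int_decode n))"
  by (metis int_encode_inverse)

lemma int_decode_even: "int_decode (2 * n) = int n"
  by (simp add: int_decode_def sum_decode_def)

text \<open>
  Writing an integer as its positive part minus its negative part reduces addition of codes to
  arithmetic on natural numbers.
\<close>

lemma computable_int_code_add:
  assumes a: "computable a" and b: "computable b"
  shows "computable (\<lambda>e. int_code_add (a e) (b e))"
proof -
  define pos where "pos n = (if even n then n div 2 else 0)" for n :: nat
  define neg where "neg n = (if even n then 0 else Suc (n div 2))" for n :: nat
  have dec: "int_decode n = int (pos n) - int (neg n)" for n
    by (simp add: pos_def neg_def int_decode_def sum_decode_def)
  have enc: "int_encode (int m - int n) = (if n \<le> m then 2 * (m - n) else 2 * (n - m) - 1)" for m n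
    by (auto simp: int_encode_def sum_encode_def nat_diff_distrib)
  have "int_code_add p q = (if neg p + neg q \<le> pos p + pos q
      then 2 * ((pos p + pos q) - (neg p + neg q)) else 2 * ((neg p + neg q) - (pos p + pos q)) - 1)"
    for p q
    unfolding int_code_add_def enc[symmetric] by (simp add: dec algebra_simps)
  moreover have "computable (\<lambda>e. pos (f e))" "computable (\<lambda>e. neg (f e))" if "computable f" for f
    unfolding pos_def neg_def using that
    by (intro computable_if decidable_pred_even computable_half computable_Suc computable_const; assumption)+
  note pn = this[OF a] this[OF b]
  ultimately show ?thesis
    by (auto intro!: computable_if decidable_pred_le computable_mult computable_diff computable_add
        computable_const pn)
qed

definition code_length :: "nat \<Rightarrow> nat" where
  "code_length c = length (list_decode c)"

text \<open>
  The value 0 beyond the end makes this the head of an iterated tail, for all indices.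
\<close>

definition code_nth :: "nat \<Rightarrow> nat \<Rightarrow> nat" where
  "code_nth c i = (if i < length (list_decode c) then list_decode c ! i else 0)"

lemma code_length_encode [simp]: "code_length (list_encode xs) = length xs"
  by (simp add: code_length_def)

lemma code_nth_encode [simp]: "i < length xs \<Longrightarrow> code_nth (list_encode xs) i = xs ! i"
  by (simp add: code_nth_def)

text \<open>
  A nonzero list code is \<open>Suc\<close> of the pair of head and tail, so this iterates the tail.
\<close>

lemma code_drop:
  "((\<lambda>c. psnd (c - 1)) ^^ n) c = list_encode (drop n (list_decode c))"
proof (induction n)
  case (Suc n)
  show ?case
  proof (cases "drop n (list_decode c)")
    case Nil
    then have "drop (Suc n) (list_decode c) = []" by simp
    with Suc Nil show ?thesis by simp
  next
    case (Cons y ys)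
    then have "drop (Suc n) (list_decode c) = ys"
      by (metis drop_Suc drop_tl list.sel(3))
    with Suc Cons show ?thesis by simp
  qed
qed simp

lemma computable_code_drop:
  assumes "computable a" "computable b"
  shows "computable (\<lambda>e. list_encode (drop (b e) (list_decode (a e))))"
proof -
  have "(f ^^ n) c = rec_nat c (\<lambda>_ y. f y) n" for f :: "nat \<Rightarrow> nat" and n c
    by (induction n) auto
  then have "list_encode (drop (b e) (list_decode (a e))) = rec_nat (a e) (\<lambda>_ c. psnd (c - 1)) (b e)" for e
    by (simp add: code_drop[symmetric])
  moreover have "computable (\<lambda>e. rec_nat (a e) (\<lambda>_ c. psnd (c - 1)) (b e))"
    by (intro computable_rec computable_psnd computable_pfst computable_diff computable_const
        computable_id assms)
  ultimately show ?thesis by simp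
qed

lemma computable_code_length:
  assumes "computable a"
  shows "computable (\<lambda>e. code_length (a e))"
proof -
  have z: "list_encode xs = 0 \<longleftrightarrow> xs = []" for xs
    by (cases xs) auto
  have "code_length c = (LEAST n. list_encode (drop n (list_decode c)) = 0)" for c
    unfolding code_length_def z by (rule Least_equality[symmetric]) auto
  moreover have "computable (\<lambda>c. LEAST n. list_encode (drop n (list_decode c)) = 0)"
    by (intro computable_Least decidable_pred_eq computable_code_drop computable_psnd computable_pfst
        computable_id computable_const) (auto simp: z)
  ultimately have "computable code_length"
    by presburger
  then show ?thesis by (rule computable_comp[OF _ assms])
qed

lemma computable_code_nth:
  assumes "computable a" "computable b"
  shows "computable (\<lambda>e. code_nth (a e) (b e))"
proof -
  have "code_nth c i = pfst (list_encode (drop i (list_decode c)) - 1)" for c i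
    by (cases "drop i (list_decode c)") (auto simp: code_nth_def Cons_nth_drop_Suc[symmetric])
  moreover have "computable (\<lambda>e. pfst (list_encode (drop (b e) (list_decode (a e))) - 1))"
    by (intro computable_pfst computable_diff computable_code_drop computable_const assms)
  ultimately show ?thesis by simp
qed

lemma computable_code_replicate:
  assumes "computable n"
  shows "computable (\<lambda>e. list_encode (replicate (n e) K))"
proof -
  have "list_encode (replicate n K) = rec_nat 0 (\<lambda>_ c. Suc (prod_encode (K, c))) n" for n
    by (induction n) auto
  moreover have "computable (\<lambda>e. rec_nat 0 (\<lambda>_ c. Suc (prod_encode (K, c))) (n e))"
    by (intro computable_rec computable_Suc computable_pair computable_pfst computable_psnd
        computable_const computable_id assms)
  ultimately show ?thesis by simp
qed

lemmas computable_intros =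
  computable_id computable_const computable_Suc computable_add computable_mult computable_diff
  computable_pair computable_pfst computable_psnd computable_half computable_if
  computable_int_code_add computable_code_length computable_code_nth computable_code_replicate

lemmas decidable_pred_intros =
  decidable_pred_const decidable_pred_not decidable_pred_conj decidable_pred_disj
  decidable_pred_imp decidable_pred_less decidable_pred_le decidable_pred_eq decidable_pred_bex
  decidable_pred_ball decidable_pred_finite

text \<open>
  This bounds the codes of all words of a given length over a finite alphabet, and so turns a
  quantifier over such words into a bounded one.
\<close>

lemma list_encode_le_replicate:
  "\<forall>y\<in>set xs. y \<le> K \<Longrightarrow> list_encode xs \<le> list_encode (replicate (length xs) K)"
proof (induction xs)
  case (Cons y xs)
  have "prod_encode (y, c) \<le> prod_encode (K, d)" if "y \<le> K" "c \<le> d" for c d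
    unfolding prod_encode_def prod.case using that by (intro add_mono triangle_mono) auto
  with Cons show ?case by simp
qed simp

section \<open>The topology of the full shift\<close>

text \<open>
  Coordinates are enumerated by \<^const>\<open>int_decode\<close>, so that the sets of points agreeing with \<open>x\<close> on the
  first \<open>s\<close> coordinates form a neighbourhood basis of \<open>x\<close> indexed by natural numbers, and such a set is
  determined by one finite list.
\<close>

definition agree :: "nat \<Rightarrow> (int \<Rightarrow> 'a) \<Rightarrow> (int \<Rightarrow> 'a) \<Rightarrow> bool" where
  "agree s x y \<longleftrightarrow> (\<forall>n<s. x (int_decode n) = y (int_decode n))"

lemma agree_refl [simp]: "agree s x x"
  by (simp add: agree_def)

lemma agree_sym: "agree s x y \<Longrightarrow> agree s y x"
  by (simp add: agree_def)

lemma agree_trans: "agree s x y \<Longrightarrow> agree s y z \<Longrightarrow> agree s x z"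
  by (simp add: agree_def)

lemma agree_mono: "agree t x y \<Longrightarrow> s \<le> t \<Longrightarrow> agree s x y"
  by (simp add: agree_def)

lemma agree_finite:
  assumes "finite I"
  obtains s where "\<And>x y :: int \<Rightarrow> 'a. agree s x y \<Longrightarrow> \<forall>i\<in>I. x i = y i"
proof -
  have "agree (Suc (Max (int_encode ` I))) x y \<longrightarrow> (\<forall>i\<in>I. x i = y i)" for x y :: "int \<Rightarrow> 'a"
  proof (intro impI ballI)
    fix i assume *: "agree (Suc (Max (int_encode ` I))) x y" "i \<in> I"
    then have "int_encode i < Suc (Max (int_encode ` I))"
      using assms by (simp add: less_Suc_eq_le)
    with *(1) show "x i = y i"
      unfolding agree_def by (metis int_encode_inverse)
  qed
  then show thesis using that by blast
qed

abbreviation full_shift :: "(int \<Rightarrow> 'a) topology" where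
  "full_shift \<equiv> product_topology (\<lambda>_. discrete_topology UNIV) UNIV"

lemma openin_full_shift_iff:
  "openin full_shift U \<longleftrightarrow> (\<forall>x\<in>U. \<exists>s. \<forall>y. agree s x y \<longrightarrow> y \<in> U)"
proof
  assume U: "openin full_shift U"
  show "\<forall>x\<in>U. \<exists>s. \<forall>y. agree s x y \<longrightarrow> y \<in> U"
  proof
    fix x assume "x \<in> U"
    then obtain W where W: "finite {i. W i \<noteq> UNIV}" "x \<in> Pi\<^sub>E UNIV W" "Pi\<^sub>E UNIV W \<subseteq> U"
      using U unfolding openin_product_topology_alt by auto
    obtain s where s: "\<And>x y :: int \<Rightarrow> 'a. agree s x y \<Longrightarrow> \<forall>i\<in>{i. W i \<noteq> UNIV}. x i = y i"
      by (rule agree_finite[OF W(1)]) blast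
    have "y \<in> U" if "agree s x y" for y
    proof -
      have "y i \<in> W i" for i
      proof (cases "W i = UNIV")
        case False
        then have "y i = x i"
          using s[OF that] by simp
        with W(2) show ?thesis by (auto simp: PiE_iff)
      qed simp
      then show ?thesis using W(3) by (auto simp: PiE_iff)
    qed
    then show "\<exists>s. \<forall>y. agree s x y \<longrightarrow> y \<in> U" by blast
  qed
next
  assume U: "\<forall>x\<in>U. \<exists>s. \<forall>y. agree s x y \<longrightarrow> y \<in> U"
  show "openin full_shift U"
    unfolding openin_product_topology_alt
  proof
    fix x assume "x \<in> U"
    then obtain s where s: "\<And>y. agree s x y \<Longrightarrow> y \<in> U"
      using U by blast
    define W where "W i = (if int_encode i < s then {x i} else UNIV)" for i
    have "{i. W i \<noteq> UNIV} \<subseteq> int_decode ` {..<s}"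
    proof
      fix i assume "i \<in> {i. W i \<noteq> UNIV}"
      then show "i \<in> int_decode ` {..<s}"
        by (intro image_eqI[of _ _ "int_encode i"]) (auto simp: W_def split: if_splits)
    qed
    then have "finite {i. W i \<noteq> UNIV}"
      by (rule finite_subset) simp
    moreover have "y \<in> U" if "\<forall>i. y i \<in> W i" for y
    proof (rule s, unfold agree_def, intro allI impI)
      fix n assume "n < s"
      with that[rule_format, of "int_decode n"] show "x (int_decode n) = y (int_decode n)"
        by (simp add: W_def)
    qed
    ultimately show "\<exists>W. finite {i \<in> UNIV. W i \<noteq> topspace (discrete_topology UNIV)} \<and>
        (\<forall>i\<in>UNIV. openin (discrete_topology UNIV) (W i)) \<and> x \<in> Pi\<^sub>E UNIV W \<and> Pi\<^sub>E UNIV W \<subseteq> U"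
      by (intro exI[of _ W]) (auto simp: PiE_iff W_def)
  qed
qed

lemma closedin_full_shift_iff:
  "closedin full_shift C \<longleftrightarrow> (\<forall>x. (\<forall>s. \<exists>y\<in>C. agree s x y) \<longrightarrow> x \<in> C)"
proof -
  have "topspace full_shift = UNIV"
    by (simp add: PiE_UNIV_domain)
  then have "closedin full_shift C \<longleftrightarrow> openin full_shift (- C)"
    by (simp add: closedin_def Compl_eq_Diff_UNIV)
  then show ?thesis
    unfolding openin_full_shift_iff by blast
qed

text \<open>
  The form in which compactness of the full shift is used throughout.
\<close>

lemma decreasing_closed_nonempty:
  fixes C :: "nat \<Rightarrow> (int \<Rightarrow> 'a::finite) set"
  assumes "\<And>n. closedin full_shift (C n)" "\<And>n. C n \<noteq> {}" "decseq C"
  obtains x where "\<And>n. x \<in> C n"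
proof -
  have "compact_space (full_shift :: (int \<Rightarrow> 'a) topology)"
    by (simp add: compact_space_product_topology compact_space_discrete_topology)
  from compact_space_imp_nest[OF this assms] that show thesis
    by blast
qed

section \<open>Semidecidable relations between parameters and configurations\<close>

definition prefix_code :: "(int \<Rightarrow> 'a::finite) \<Rightarrow> nat \<Rightarrow> nat" where
  "prefix_code x s = list_encode (map (\<lambda>i. to_nat (x (int_decode i))) [0..<s])"

text \<open>
  An oracle version of semidecidability: the relation between \<open>e\<close> and the configuration \<open>x\<close> is
  confirmed by a decidable test \<open>R\<close> that sees \<open>e\<close> and a finite part of \<open>x\<close>. The length of that part
  also serves as the bound of all searches. Persistence of \<open>R\<close> under longer prefixes lets finitely many
  confirmations be carried out on one common prefix. Relations on numbers alone are the case in which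
  \<open>x\<close> does not occur.
\<close>

definition semidecidable :: "(nat \<Rightarrow> (int \<Rightarrow> 'a::finite) \<Rightarrow> bool) \<Rightarrow> bool" where
  "semidecidable Q \<longleftrightarrow>
     (\<exists>R. decidable_pred (\<lambda>p. R (pfst p) (psnd p)) \<and>
       (\<forall>e (x :: int \<Rightarrow> 'a) s t. s \<le> t \<longrightarrow> R e (prefix_code x s) \<longrightarrow> R e (prefix_code x t)) \<and>
       (\<forall>e x. Q e x \<longleftrightarrow> (\<exists>s. R e (prefix_code x s))))"

lemma semidecidableI:
  fixes Q :: "nat \<Rightarrow> (int \<Rightarrow> 'a::finite) \<Rightarrow> bool"
  assumes "decidable_pred (\<lambda>p. R (pfst p) (psnd p))"
    and "\<And>e (x :: int \<Rightarrow> 'a) s t. s \<le> t \<Longrightarrow> R e (prefix_code x s) \<Longrightarrow> R e (prefix_code x t)"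
    and "\<And>e x. Q e x \<longleftrightarrow> (\<exists>s. R e (prefix_code x s))"
  shows "semidecidable Q"
  unfolding semidecidable_def using assms by blast

lemma semidecidableE:
  fixes Q :: "nat \<Rightarrow> (int \<Rightarrow> 'a::finite) \<Rightarrow> bool"
  assumes "semidecidable Q"
  obtains R where "decidable_pred (\<lambda>p. R (pfst p) (psnd p))"
    and "\<And>e (x :: int \<Rightarrow> 'a) s t. s \<le> t \<Longrightarrow> R e (prefix_code x s) \<Longrightarrow> R e (prefix_code x t)"
    and "\<And>e x. Q e x \<longleftrightarrow> (\<exists>s. R e (prefix_code x s))"
  using assms unfolding semidecidable_def by blast

lemma code_length_prefix [simp]: "code_length (prefix_code x s) = s"
  by (simp add: prefix_code_def)

lemma code_nth_prefix [simp]: "i < s \<Longrightarrow> code_nth (prefix_code x s) i = to_nat (x (int_decode i))"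
  by (simp add: prefix_code_def)

lemma decidable_pred_subst2:
  assumes "decidable_pred (\<lambda>p. R (pfst p) (psnd p))" "computable a" "computable b"
  shows "decidable_pred (\<lambda>e. R (a e) (b e))"
  using decidable_pred_subst[OF assms(1) computable_pair[OF assms(2,3)]] by simp

lemma semidecidable_decidable:
  assumes "decidable_pred P"
  shows "semidecidable (\<lambda>e x. P e)"
  by (rule semidecidableI[where R = "\<lambda>e c. P e"])
    (auto intro!: decidable_pred_subst[OF assms] computable_intros)

lemma semidecidable_conj:
  fixes Q Q' :: "nat \<Rightarrow> (int \<Rightarrow> 'a::finite) \<Rightarrow> bool"
  assumes "semidecidable Q" "semidecidable Q'"
  shows "semidecidable (\<lambda>e x. Q e x \<and> Q' e x)"
proof -
  from assms(1) obtain R where R: "decidable_pred (\<lambda>p. R (pfst p) (psnd p))"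
      "\<And>e (x :: int \<Rightarrow> 'a) s t. s \<le> t \<Longrightarrow> R e (prefix_code x s) \<Longrightarrow> R e (prefix_code x t)"
      "\<And>e x. Q e x \<longleftrightarrow> (\<exists>s. R e (prefix_code x s))"
    by (rule semidecidableE) blast
  from assms(2) obtain R' where R': "decidable_pred (\<lambda>p. R' (pfst p) (psnd p))"
      "\<And>e (x :: int \<Rightarrow> 'a) s t. s \<le> t \<Longrightarrow> R' e (prefix_code x s) \<Longrightarrow> R' e (prefix_code x t)"
      "\<And>e x. Q' e x \<longleftrightarrow> (\<exists>s. R' e (prefix_code x s))"
    by (rule semidecidableE) blast
  show ?thesis
  proof (rule semidecidableI[where R = "\<lambda>e c. R e c \<and> R' e c"])
    show "Q e x \<and> Q' e x \<longleftrightarrow> (\<exists>s. R e (prefix_code x s) \<and> R' e (prefix_code x s))" for e x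
      unfolding R(3) R'(3) by (meson R(2) R'(2) max.cobounded1 max.cobounded2)
  qed (use R(2) R'(2) in \<open>auto intro: decidable_pred_conj R(1) R'(1)\<close>)
qed

lemma semidecidable_disj:
  fixes Q Q' :: "nat \<Rightarrow> (int \<Rightarrow> 'a::finite) \<Rightarrow> bool"
  assumes "semidecidable Q" "semidecidable Q'"
  shows "semidecidable (\<lambda>e x. Q e x \<or> Q' e x)"
proof -
  from assms(1) obtain R where R: "decidable_pred (\<lambda>p. R (pfst p) (psnd p))"
      "\<And>e (x :: int \<Rightarrow> 'a) s t. s \<le> t \<Longrightarrow> R e (prefix_code x s) \<Longrightarrow> R e (prefix_code x t)"
      "\<And>e x. Q e x \<longleftrightarrow> (\<exists>s. R e (prefix_code x s))"
    by (rule semidecidableE) blast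
  from assms(2) obtain R' where R': "decidable_pred (\<lambda>p. R' (pfst p) (psnd p))"
      "\<And>e (x :: int \<Rightarrow> 'a) s t. s \<le> t \<Longrightarrow> R' e (prefix_code x s) \<Longrightarrow> R' e (prefix_code x t)"
      "\<And>e x. Q' e x \<longleftrightarrow> (\<exists>s. R' e (prefix_code x s))"
    by (rule semidecidableE) blast
  show ?thesis
    by (rule semidecidableI[where R = "\<lambda>e c. R e c \<or> R' e c"])
      (use R(2,3) R'(2,3) in \<open>auto intro: decidable_pred_disj R(1) R'(1)\<close>)
qed

text \<open>
  The length of the inspected prefix bounds the search for a witness.
\<close>

lemma semidecidable_ex:
  fixes Q :: "nat \<Rightarrow> nat \<Rightarrow> (int \<Rightarrow> 'a::finite) \<Rightarrow> bool"
  assumes "semidecidable (\<lambda>p x. Q (pfst p) (psnd p) x)"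
  shows "semidecidable (\<lambda>e x. \<exists>y. Q y e x)"
proof -
  from assms obtain R where R: "decidable_pred (\<lambda>p. R (pfst p) (psnd p))"
      "\<And>e (x :: int \<Rightarrow> 'a) s t. s \<le> t \<Longrightarrow> R e (prefix_code x s) \<Longrightarrow> R e (prefix_code x t)"
      "\<And>p x. Q (pfst p) (psnd p) x \<longleftrightarrow> (\<exists>s. R p (prefix_code x s))"
    by (rule semidecidableE) blast
  have Q: "Q y e x \<longleftrightarrow> (\<exists>s. R (prod_encode (y, e)) (prefix_code x s))" for y e x
    using R(3)[of "prod_encode (y, e)"] by simp
  let ?R = "\<lambda>e c. \<exists>y<code_length c. R (prod_encode (y, e)) c"
  show ?thesis
  proof (rule semidecidableI[where R = ?R])
    show "decidable_pred (\<lambda>p. ?R (pfst p) (psnd p))"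
      by (intro decidable_pred_intros decidable_pred_subst2[OF R(1)] computable_intros)
    show "?R e (prefix_code x s) \<Longrightarrow> ?R e (prefix_code x t)" if "s \<le> t"
      for e s t and x :: "int \<Rightarrow> 'a"
      using that R(2)[OF that] by (auto intro: less_le_trans)
    show "(\<exists>y. Q y e x) \<longleftrightarrow> (\<exists>s. ?R e (prefix_code x s))" for e x
    proof
      assume "\<exists>y. Q y e x"
      then obtain y s where "R (prod_encode (y, e)) (prefix_code x s)"
        unfolding Q by blast
      then have "R (prod_encode (y, e)) (prefix_code x (max s (Suc y)))"
        by (rule R(2)[rotated]) simp
      then show "\<exists>s. ?R e (prefix_code x s)"
        by (intro exI[of _ "max s (Suc y)"] exI[of _ y]) (simp add: less_Suc_eq_le)
    qed (auto simp: Q)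
  qed
qed

lemma semidecidable_ball:
  fixes Q :: "nat \<Rightarrow> nat \<Rightarrow> (int \<Rightarrow> 'a::finite) \<Rightarrow> bool"
  assumes Q: "semidecidable (\<lambda>p x. Q (pfst p) (psnd p) x)" and b: "computable b"
  shows "semidecidable (\<lambda>e x. \<forall>y<b e. Q y e x)"
proof -
  from assms(1) obtain R where R: "decidable_pred (\<lambda>p. R (pfst p) (psnd p))"
      "\<And>e (x :: int \<Rightarrow> 'a) s t. s \<le> t \<Longrightarrow> R e (prefix_code x s) \<Longrightarrow> R e (prefix_code x t)"
      "\<And>p x. Q (pfst p) (psnd p) x \<longleftrightarrow> (\<exists>s. R p (prefix_code x s))"
    by (rule semidecidableE) blast
  have Q: "Q y e x \<longleftrightarrow> (\<exists>s. R (prod_encode (y, e)) (prefix_code x s))" for y e x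
    using R(3)[of "prod_encode (y, e)"] by simp
  let ?R = "\<lambda>e c. \<forall>y<b e. R (prod_encode (y, e)) c"
  show ?thesis
  proof (rule semidecidableI[where R = ?R])
    show "decidable_pred (\<lambda>p. ?R (pfst p) (psnd p))"
      by (intro decidable_pred_intros decidable_pred_subst2[OF R(1)] computable_comp[OF b] computable_intros)
    show "?R e (prefix_code x s) \<Longrightarrow> ?R e (prefix_code x t)" if "s \<le> t"
      for e s t and x :: "int \<Rightarrow> 'a"
      using R(2)[OF that] by blast
    show "(\<forall>y<b e. Q y e x) \<longleftrightarrow> (\<exists>s. ?R e (prefix_code x s))" for e x
    proof
      assume "\<forall>y<b e. Q y e x"
      then have "\<forall>y. \<exists>s. y < b e \<longrightarrow> R (prod_encode (y, e)) (prefix_code x s)"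
        unfolding Q by blast
      then obtain s where s: "\<And>y. y < b e \<Longrightarrow> R (prod_encode (y, e)) (prefix_code x (s y))"
        by metis
      have "R (prod_encode (y, e)) (prefix_code x (Max (s ` {..<b e})))" if "y < b e" for y
        by (rule R(2)[OF _ s[OF that]]) (use that in \<open>auto intro!: Max_ge\<close>)
      then show "\<exists>s. ?R e (prefix_code x s)"
        by blast
    qed (auto simp: Q)
  qed
qed

lemma semidecidable_finite_disj:
  assumes "finite I" "\<And>i. i \<in> I \<Longrightarrow> semidecidable (Q i)"
  shows "semidecidable (\<lambda>e x. \<exists>i\<in>I. Q i e x)"
  using assms
proof (induction I)
  case empty
  show ?case by (simp add: semidecidable_decidable decidable_pred_const)
next
  case (insert i I)
  then show ?case by (simp add: semidecidable_disj)
qed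

lemma semidecidable_finite_conj:
  assumes "finite I" "\<And>i. i \<in> I \<Longrightarrow> semidecidable (Q i)"
  shows "semidecidable (\<lambda>e x. \<forall>i\<in>I. Q i e x)"
  using assms
proof (induction I)
  case empty
  show ?case by (simp add: semidecidable_decidable decidable_pred_const)
next
  case (insert i I)
  then show ?case by (simp add: semidecidable_conj)
qed

lemma semidecidable_letter:
  assumes a: "computable a" and D: "decidable_pred (\<lambda>p. D (pfst p) (psnd p))"
  shows "semidecidable (\<lambda>e x. D (to_nat (x (int_decode (a e)))) e)"
  by (rule semidecidableI[where R = "\<lambda>e c. a e < code_length c \<and> D (code_nth c (a e)) e"])
    (auto intro!: decidable_pred_intros decidable_pred_subst2[OF D] computable_comp[OF a] computable_intros)

lemma semidecidable_letter_eq: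
  assumes a: "computable a" and b: "computable b"
  shows "semidecidable (\<lambda>e x. to_nat (x (int_decode (a e))) = b e)"
  by (rule semidecidable_letter[OF a]) (intro decidable_pred_intros computable_comp[OF b] computable_intros)

lemma semidecidable_letter_neq:
  assumes a: "computable a" and b: "computable b"
  shows "semidecidable (\<lambda>e x. to_nat (x (int_decode (a e))) \<noteq> b e)"
  by (rule semidecidable_letter[OF a]) (intro decidable_pred_intros computable_comp[OF b] computable_intros)

lemma prefix_code_eq_iff: "prefix_code x s = prefix_code y s \<longleftrightarrow> agree s x y"
  by (auto simp: prefix_code_def list_encode_eq agree_def)

text \<open>
  If no length worked for all points, the closed sets of points not yet confirmed would have a common
  element.
\<close>

lemma prefix_bound:
  fixes R :: "nat \<Rightarrow> bool"
  assumes mono: "\<And>(x :: int \<Rightarrow> 'a::finite) s t. s \<le> t \<Longrightarrow> R (prefix_code x s) \<Longrightarrow> R (prefix_code x t)"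
    and ex: "\<And>x :: int \<Rightarrow> 'a. \<exists>s. R (prefix_code x s)"
  shows "\<exists>s. \<forall>x :: int \<Rightarrow> 'a. R (prefix_code x s)"
proof (rule ccontr)
  assume neg: "\<nexists>s. \<forall>x :: int \<Rightarrow> 'a. R (prefix_code x s)"
  define C where "C s = {x :: int \<Rightarrow> 'a. \<not> R (prefix_code x s)}" for s
  have "closedin full_shift (C s)" for s
    unfolding closedin_full_shift_iff C_def by (metis mem_Collect_eq prefix_code_eq_iff)
  moreover have "C s \<noteq> {}" for s
    using neg by (auto simp: C_def)
  moreover have "decseq C"
    using mono by (auto simp: decseq_def C_def)
  ultimately obtain x where "\<And>s. x \<in> C s"
    by (rule decreasing_closed_nonempty) blast
  with ex[of x] show False by (auto simp: C_def)
qed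

text \<open>
  Every word over the coded alphabet occurs as the initial part of some configuration.
\<close>

lemma list_of_prefix:
  assumes "length ys = s" "set ys \<subseteq> range (to_nat :: 'a::finite \<Rightarrow> nat)"
  obtains x :: "int \<Rightarrow> 'a::finite" where "prefix_code x s = list_encode ys"
proof -
  have "to_nat (from_nat (ys ! i) :: 'a) = ys ! i" if "i < s" for i
  proof -
    have "ys ! i \<in> range (to_nat :: 'a \<Rightarrow> nat)"
      using that assms nth_mem[of i ys] by blast
    then show ?thesis by auto
  qed
  then have "prefix_code (\<lambda>k. from_nat (ys ! int_encode k) :: 'a) s = list_encode ys"
    using assms(1) by (auto simp: prefix_code_def list_encode_eq intro!: nth_equalityI)
  then show thesis by (rule that)
qed

text \<open>
  By compactness, if every configuration is confirmed then a single prefix length confirms all of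
  them; and there are only finitely many prefixes of that length to check. This is the source of every
  effective compactness argument below.
\<close>

lemma semidecidable_all:
  fixes Q :: "nat \<Rightarrow> (int \<Rightarrow> 'a::finite) \<Rightarrow> bool"
  assumes "semidecidable Q"
  shows "semidecidable (\<lambda>e (x :: int \<Rightarrow> 'a). \<forall>y. Q e y)"
proof -
  from assms obtain R where R: "decidable_pred (\<lambda>p. R (pfst p) (psnd p))"
      "\<And>e (x :: int \<Rightarrow> 'a) s t. s \<le> t \<Longrightarrow> R e (prefix_code x s) \<Longrightarrow> R e (prefix_code x t)"
      "\<And>e x. Q e x \<longleftrightarrow> (\<exists>s. R e (prefix_code x s))"
    by (rule semidecidableE) blast
  define A where "A = range (to_nat :: 'a \<Rightarrow> nat)"
  have "finite A" by (simp add: A_def)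
  \<comment> \<open>Codes of prefixes of length \<open>s\<close> are bounded by that of \<open>s\<close> copies of the largest letter, so
    the quantifier over them becomes a bounded one.\<close>
  define K where "K = Max A"
  define is_prefix where "is_prefix s c \<longleftrightarrow> code_length c = s \<and> (\<forall>i<s. code_nth c i \<in> A)" for s c
  have prefix: "is_prefix s c \<longleftrightarrow> (\<exists>x :: int \<Rightarrow> 'a. c = prefix_code x s)" for s c
  proof
    assume "is_prefix s c"
    then have *: "length (list_decode c) = s" "set (list_decode c) \<subseteq> A"
      by (auto simp: is_prefix_def code_length_def code_nth_def in_set_conv_nth)
    from list_of_prefix[OF this[unfolded A_def]] obtain x :: "int \<Rightarrow> 'a"
      where "prefix_code x s = list_encode (list_decode c)" by blast
    then show "\<exists>x :: int \<Rightarrow> 'a. c = prefix_code x s"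
      by (auto intro!: exI[of _ x])
  qed (auto simp: is_prefix_def A_def)
  have bound: "prefix_code x s < Suc (list_encode (replicate s K))" for x :: "int \<Rightarrow> 'a" and s
    using list_encode_le_replicate[of "map (\<lambda>i. to_nat (x (int_decode i))) [0..<s]" K] \<open>finite A\<close>
    by (auto simp: prefix_code_def less_Suc_eq_le K_def A_def)
  let ?R = "\<lambda>e d. \<forall>c<Suc (list_encode (replicate (code_length d) K)).
    is_prefix (code_length d) c \<longrightarrow> R e c"
  have R_iff: "?R e (prefix_code x s) \<longleftrightarrow> (\<forall>y :: int \<Rightarrow> 'a. R e (prefix_code y s))"
    for e s and x :: "int \<Rightarrow> 'a"
    using bound by (auto simp: prefix)
  show ?thesis
  proof (rule semidecidableI[where R = ?R])
    show "decidable_pred (\<lambda>p. ?R (pfst p) (psnd p))"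
      unfolding is_prefix_def
      by (intro decidable_pred_intros decidable_pred_subst2[OF R(1)] computable_intros \<open>finite A\<close>)
    show "?R e (prefix_code x s) \<Longrightarrow> ?R e (prefix_code x t)" if "s \<le> t"
      for e s t and x :: "int \<Rightarrow> 'a"
      unfolding R_iff using R(2)[OF that] by blast
    have "\<exists>s. \<forall>y :: int \<Rightarrow> 'a. R e (prefix_code y s)"
      if "\<forall>y :: int \<Rightarrow> 'a. \<exists>s. R e (prefix_code y s)" for e
      by (rule prefix_bound) (use R(2) that in blast)+
    then show "(\<forall>y. Q e y) \<longleftrightarrow> (\<exists>s. ?R e (prefix_code x s))" for e and x :: "int \<Rightarrow> 'a"
      unfolding R_iff R(3) by blast
  qed
qed

text \<open>
  Post's theorem. As neither relation depends on the configuration, both tests are run on the prefixes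
  of a constant one until one of them succeeds.
\<close>

lemma decidable_if_semidecidable_both:
  assumes "semidecidable (\<lambda>e (x :: int \<Rightarrow> 'a::finite). P e)"
    and "semidecidable (\<lambda>e (x :: int \<Rightarrow> 'a::finite). \<not> P e)"
  shows "decidable {e. P e}"
proof -
  from assms(1) obtain R where R: "decidable_pred (\<lambda>p. R (pfst p) (psnd p))"
      "\<And>e (x :: int \<Rightarrow> 'a). P e \<longleftrightarrow> (\<exists>s. R e (prefix_code x s))"
    by (rule semidecidableE) blast
  from assms(2) obtain R' where R': "decidable_pred (\<lambda>p. R' (pfst p) (psnd p))"
      "\<And>e (x :: int \<Rightarrow> 'a). \<not> P e \<longleftrightarrow> (\<exists>s. R' e (prefix_code x s))"
    by (rule semidecidableE) blast
  define a where "a = (undefined :: 'a)"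
  define pc where "pc s = list_encode (replicate s (to_nat a))" for s
  have pc: "pc s = prefix_code (\<lambda>_. a) s" for s
    by (simp add: pc_def prefix_code_def map_replicate_const)
  define S where "S e = (LEAST s. R e (pc s) \<or> R' e (pc s))" for e
  have ex: "\<exists>s. R e (pc s) \<or> R' e (pc s)" for e
    unfolding pc using R(2)[of e "\<lambda>_. a"] R'(2)[of e "\<lambda>_. a"] by blast
  have "computable S"
    unfolding S_def
  proof (rule computable_Least[OF _ ex])
    show "decidable_pred (\<lambda>p. R (psnd p) (pc (pfst p)) \<or> R' (psnd p) (pc (pfst p)))"
      unfolding pc_def
      by (intro decidable_pred_intros decidable_pred_subst2[OF R(1)] decidable_pred_subst2[OF R'(1)]
          computable_intros)
  qed
  moreover have "P e \<longleftrightarrow> R e (pc (S e))" for e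
    using LeastI_ex[OF ex[of e]] R(2)[of e "\<lambda>_. a"] R'(2)[of e "\<lambda>_. a"] unfolding S_def pc by blast
  moreover have "decidable_pred (\<lambda>e. R e (pc (S e)))"
    unfolding pc_def
    by (intro decidable_pred_subst2[OF R(1)] computable_intros \<open>computable S\<close>)
  ultimately have "computable (\<lambda>e. of_bool (P e))"
    by (simp add: decidable_pred_def)
  then obtain f where f: "\<And>xs. length xs = 1 \<Longrightarrow> computes f xs (of_bool (P (xs ! 0)))"
    unfolding computable_def total_recursive_def by blast
  have "computes f [n] (if n \<in> {e. P e} then 1 else 0)" for n
    using f[of "[n]"] by (simp add: of_bool_def)
  then show ?thesis unfolding decidable_def by blast
qed

lemmas semidecidable_intros =
  semidecidable_conj semidecidable_disj semidecidable_ex semidecidable_ball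
  semidecidable_letter_eq semidecidable_letter_neq

section \<open>Recursively enumerable sets\<close>

lemma computes_Zero_iff: "computes Zero xs z \<longleftrightarrow> z = 0"
  by (auto intro: computes.intros elim: computes_ZeroE)

lemma computes_Succ_iff: "computes Succ xs z \<longleftrightarrow> (\<exists>x. xs = [x] \<and> z = Suc x)"
  by (auto intro: computes.intros elim: computes_SuccE)

lemma computes_Proj_iff: "computes (Proj i) xs z \<longleftrightarrow> i < length xs \<and> z = xs ! i"
  by (auto intro: computes.intros elim: computes_ProjE)

text \<open>
  The intermediate values are packed into one list code, so that a single quantifier over numbers
  covers them.
\<close>

lemma computes_Comp_iff:
  "computes (Comp f gs) xs z \<longleftrightarrow>
    (\<exists>c. (\<forall>i\<in>{..<length gs}. computes (gs ! i) xs (code_nth c i)) \<and>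
         computes f (map (code_nth c) [0..<length gs]) z)" (is "?L \<longleftrightarrow> ?R")
proof
  assume ?L
  then obtain ys where ys: "list_all2 (\<lambda>g y. computes g xs y) gs ys" "computes f ys z"
    by (rule computes_CompE)
  then have len: "length ys = length gs"
    by (simp add: list_all2_lengthD)
  then have "map (code_nth (list_encode ys)) [0..<length gs] = ys"
    by (auto intro: nth_equalityI)
  then show ?R
    using ys len by (auto simp: list_all2_conv_all_nth intro!: exI[of _ "list_encode ys"])
next
  assume ?R
  then show ?L
    by (auto intro!: computes.Comp simp: list_all2_conv_all_nth)
qed

text \<open>
  A computation by primitive recursion is given by the list of its successive values.
\<close>

lemma computes_PrimRec_iff:
  "computes (PrimRec f g) (n # xs) z \<longleftrightarrow>
    (\<exists>c. computes f xs (code_nth c 0) \<and>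
      (\<forall>k<n. computes g (k # code_nth c k # xs) (code_nth c (Suc k))) \<and> code_nth c n = z)"
    (is "_ \<longleftrightarrow> (\<exists>c. ?R c n z)")
proof
  assume "computes (PrimRec f g) (n # xs) z"
  then have "\<exists>ys. length ys = Suc n \<and> computes f xs (ys ! 0) \<and>
      (\<forall>k<n. computes g (k # ys ! k # xs) (ys ! Suc k)) \<and> ys ! n = z"
  proof (induction n arbitrary: z)
    case 0
    then show ?case
      by (auto elim!: computes_PrimRec_0E intro!: exI[of _ "[z]"])
  next
    case (Suc n)
    from Suc.prems obtain y where y: "computes (PrimRec f g) (n # xs) y"
      "computes g (n # y # xs) z"
      by (rule computes_PrimRec_SucE)
    from Suc.IH[OF y(1)] obtain ys where "length ys = Suc n" "computes f xs (ys ! 0)"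
      "\<forall>k<n. computes g (k # ys ! k # xs) (ys ! Suc k)" "ys ! n = y"
      by blast
    with y(2) show ?case
      by (intro exI[of _ "ys @ [z]"]) (auto simp: nth_append less_Suc_eq)
  qed
  then obtain ys where "length ys = Suc n" "computes f xs (ys ! 0)"
      "\<forall>k<n. computes g (k # ys ! k # xs) (ys ! Suc k)" "ys ! n = z"
    by blast
  then show "\<exists>c. ?R c n z"
    by (intro exI[of _ "list_encode ys"]) auto
next
  assume "\<exists>c. ?R c n z"
  then obtain c where c: "?R c n z" by blast
  have "computes (PrimRec f g) (m # xs) (code_nth c m)" if "m \<le> n" for m
    using that
  proof (induction m)
    case 0
    show ?case using c by (auto intro: computes.PrimRec_0)
  next
    case (Suc m)
    then show ?case using c by (auto intro!: computes.PrimRec_Suc)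
  qed
  with c show "computes (PrimRec f g) (n # xs) z" by blast
qed

lemma computes_PrimRec_Nil: "\<not> computes (PrimRec f g) [] z"
  by (auto elim: computes.cases)

lemma computes_Mu_iff:
  "computes (Mu f) xs z \<longleftrightarrow>
    computes f (z # xs) 0 \<and> (\<forall>m<z. \<exists>y. computes f (m # xs) (Suc y))"
proof -
  have "(\<exists>y>0. computes f (m # xs) y) \<longleftrightarrow> (\<exists>y. computes f (m # xs) (Suc y))" for m
    using gr0_conv_Suc by auto
  then show ?thesis
    by (auto intro: computes.Mu elim!: computes_MuE)
qed

text \<open>
  The argument list is built from computable functions of the environment because the induction
  hypotheses are applied to arguments that have been computed or quantified over.
\<close>

lemma semidecidable_computes:
  assumes "\<forall>a\<in>set as. computable a" "computable b"
  shows "semidecidable (\<lambda>e (x :: int \<Rightarrow> 'a::finite). computes f (map (\<lambda>a. a e) as) (b e))"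
  using assms
proof (induction f arbitrary: as b)
  case Zero
  then show ?case
    unfolding computes_Zero_iff by (intro semidecidable_decidable decidable_pred_intros computable_intros)
next
  case Succ
  show ?case
  proof (cases "\<exists>a. as = [a]")
    case True
    with Succ show ?thesis
      by (auto simp: computes_Succ_iff intro!: semidecidable_decidable decidable_pred_eq computable_Suc)
  next
    case False
    then have "\<not> computes Succ (map (\<lambda>a. a e) as) (b e)" for e
      by (auto simp: computes_Succ_iff)
    then show ?thesis
      by (simp add: semidecidable_decidable decidable_pred_const)
  qed
next
  case (Proj i)
  show ?case
  proof (cases "i < length as")
    case True
    with Proj show ?thesis
      by (auto simp: computes_Proj_iff intro!: semidecidable_decidable decidable_pred_eq)
  next
    case False
    then show ?thesis
      by (simp add: computes_Proj_iff semidecidable_decidable decidable_pred_const)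
  qed
next
  case (Comp f gs)
  have as: "map (\<lambda>a. a (psnd p)) as = map (\<lambda>a. a p) (map (\<lambda>a p. a (psnd p)) as)" for p
    by simp
  have ys: "map (code_nth (pfst p)) [0..<n] = map (\<lambda>a. a p) (map (\<lambda>i p. code_nth (pfst p) i) [0..<n])"
    for p n by simp
  have 1: "semidecidable (\<lambda>p (x :: int \<Rightarrow> 'a). computes (gs ! i) (map (\<lambda>a. a (psnd p)) as) (code_nth (pfst p) i))"
    if "i \<in> {..<length gs}" for i
    unfolding as
    by (rule Comp.IH(2)) (use that Comp.prems in \<open>auto intro!: computable_intros computable_comp[of _ psnd]\<close>)
  have 2: "semidecidable (\<lambda>p (x :: int \<Rightarrow> 'a). computes f (map (code_nth (pfst p)) [0..<length gs]) (b (psnd p)))"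
    unfolding ys
    by (rule Comp.IH(1)) (auto intro!: computable_intros computable_comp[OF Comp.prems(2)])
  show ?case
    unfolding computes_Comp_iff
    by (intro semidecidable_ex semidecidable_conj semidecidable_finite_conj 1 2 finite_lessThan)
next
  case (PrimRec f g)
  show ?case
  proof (cases as)
    case Nil
    then show ?thesis
      by (simp add: computes_PrimRec_Nil semidecidable_decidable decidable_pred_const)
  next
    case (Cons n as')
    with PrimRec.prems have n: "computable n" and as': "\<forall>a\<in>set as'. computable a" by auto
    have eq1: "map (\<lambda>a. a (psnd p)) as' = map (\<lambda>a. a p) (map (\<lambda>a p. a (psnd p)) as')" for p
      by simp
    have eq2: "pfst p # code_nth (pfst (psnd p)) (pfst p) # map (\<lambda>a. a (psnd (psnd p))) as' =
      map (\<lambda>a. a p) (pfst # (\<lambda>p. code_nth (pfst (psnd p)) (pfst p)) # map (\<lambda>a p. a (psnd (psnd p))) as')" for p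
      by simp
    have 1: "semidecidable (\<lambda>p (x :: int \<Rightarrow> 'a). computes f (map (\<lambda>a. a (psnd p)) as') (code_nth (pfst p) 0))"
      unfolding eq1
      by (rule PrimRec.IH(1)) (use as' in \<open>auto intro!: computable_intros computable_comp[of _ psnd]\<close>)
    have 2: "semidecidable (\<lambda>p (x :: int \<Rightarrow> 'a). computes g
      (pfst p # code_nth (pfst (psnd p)) (pfst p) # map (\<lambda>a. a (psnd (psnd p))) as')
      (code_nth (pfst (psnd p)) (Suc (pfst p))))"
      unfolding eq2
      by (rule PrimRec.IH(2))
        (use as' in \<open>auto intro!: computable_intros computable_comp[of _ "\<lambda>p. psnd (psnd p)"]\<close>)
    have n': "computable (\<lambda>p. n (psnd p))" and b': "computable (\<lambda>p. b (psnd p))"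
      by (intro computable_comp[OF n] computable_comp[OF PrimRec.prems(2)] computable_intros)+
    show ?thesis
      unfolding Cons list.map computes_PrimRec_iff
      by (intro semidecidable_ex semidecidable_conj semidecidable_ball 1 2 n' semidecidable_decidable
          decidable_pred_eq b' computable_intros)
  qed
next
  case (Mu f)
  have eq1: "b e # map (\<lambda>a. a e) as = map (\<lambda>a. a e) (b # as)" for e
    by simp
  have eq2: "pfst (psnd p) # map (\<lambda>a. a (psnd (psnd p))) as =
      map (\<lambda>a. a p) ((\<lambda>p. pfst (psnd p)) # map (\<lambda>a p. a (psnd (psnd p))) as)" for p
    by simp
  have 1: "semidecidable (\<lambda>e (x :: int \<Rightarrow> 'a). computes f (b e # map (\<lambda>a. a e) as) 0)"
    unfolding eq1 by (rule Mu.IH) (use Mu.prems in \<open>auto intro!: computable_intros\<close>)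
  have 2: "semidecidable (\<lambda>p (x :: int \<Rightarrow> 'a). computes f
      (pfst (psnd p) # map (\<lambda>a. a (psnd (psnd p))) as) (Suc (pfst p)))"
    unfolding eq2 by (rule Mu.IH)
      (use Mu.prems in \<open>auto intro!: computable_intros computable_comp[of _ "\<lambda>p. psnd (psnd p)"]\<close>)
  show ?case
    unfolding computes_Mu_iff
    by (intro semidecidable_conj semidecidable_ball semidecidable_ex 1 2 Mu.prems)
qed

lemma semidecidable_recursively_enumerable:
  assumes "recursively_enumerable A" "computable a"
  shows "semidecidable (\<lambda>e (x :: int \<Rightarrow> 'a::finite). a e \<in> A)"
proof -
  obtain f where f: "\<And>n. n \<in> A \<longleftrightarrow> (\<exists>y. computes f [n] y)"
    using assms(1) unfolding recursively_enumerable_def by blast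
  have "semidecidable (\<lambda>p (x :: int \<Rightarrow> 'a). computes f [a (psnd p)] (pfst p))"
    using semidecidable_computes[of "[\<lambda>p. a (psnd p)]" pfst f]
    by (simp add: computable_intros computable_comp[OF assms(2)])
  then show ?thesis
    unfolding f by (rule semidecidable_ex)
qed

section \<open>Shifts, clopen sets and limit sets\<close>

definition shift_by :: "int \<Rightarrow> (int \<Rightarrow> 'a) \<Rightarrow> (int \<Rightarrow> 'a)" where
  "shift_by i x = (\<lambda>k. x (k + i))"

lemma shift_by_0 [simp]: "shift_by 0 x = x"
  by (simp add: shift_by_def)

lemma shift_by_shift_by [simp]: "shift_by i (shift_by j x) = shift_by (i + j) x"
  by (simp add: shift_by_def algebra_simps)

lemma shift_map_eq: "shift_map = shift_by 1"
  by (simp add: shift_by_def shift_map_def fun_eq_iff)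

lemma shift_map_funpow: "(shift_map ^^ n) x = shift_by (int n) x"
  by (induction n) (simp_all add: shift_map_eq)

lemma subshift_shift_by:
  assumes "subshift X" "x \<in> X"
  shows "shift_by i x \<in> X"
proof -
  have img: "shift_by 1 ` X = X"
    using assms(1) by (simp add: subshift_def shift_map_eq)
  have up: "shift_by 1 y \<in> X" if "y \<in> X" for y
    using img that by blast
  have down: "shift_by (- 1) y \<in> X" if "y \<in> X" for y
  proof -
    obtain z where "z \<in> X" "y = shift_by 1 z"
      using img \<open>y \<in> X\<close> by blast
    then show ?thesis by simp
  qed
  show ?thesis
  proof (induction i rule: int_induct[where k = 0])
    case base
    show ?case using assms(2) by simp
  next
    case (step1 i)
    then show ?case using up[of "shift_by i x"] by (simp add: add.commute)
  next
    case (step2 i)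
    then show ?case using down[of "shift_by i x"] by simp
  qed
qed

lemma subshift_closed:
  "subshift X \<Longrightarrow> (\<And>s. \<exists>y\<in>X. agree s x y) \<Longrightarrow> x \<in> X"
  unfolding subshift_def closedin_full_shift_iff by blast

lemma subshiftI:
  assumes "\<And>x. (\<And>s. \<exists>y\<in>X. agree s x y) \<Longrightarrow> x \<in> X"
    and "\<And>x i. x \<in> X \<Longrightarrow> shift_by i x \<in> X"
  shows "subshift X"
proof -
  have "x \<in> shift_by 1 ` X" if "x \<in> X" for x
    using assms(2)[OF that, of "-1"] by (intro image_eqI[of _ _ "shift_by (-1) x"]) auto
  then have "shift_by 1 ` X = X"
    using assms(2) by auto
  then show ?thesis
    using assms(1) unfolding subshift_def closedin_full_shift_iff shift_map_eq by blast
qed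

lemma agree_shift_by:
  obtains t where "\<And>x y :: int \<Rightarrow> 'a. agree t x y \<Longrightarrow> agree s (shift_by i x) (shift_by i y)"
proof -
  obtain t where t: "\<And>x y :: int \<Rightarrow> 'a. agree t x y \<Longrightarrow>
      \<forall>k\<in>(\<lambda>n. int_decode n + i) ` {..<s}. x k = y k"
    by (rule agree_finite[of "(\<lambda>n. int_decode n + i) ` {..<s}"]) auto
  have "agree s (shift_by i x) (shift_by i y)" if "agree t x y" for x y :: "int \<Rightarrow> 'a"
    using t[OF that] by (simp add: agree_def shift_by_def)
  then show thesis by (rule that)
qed

text \<open>
  The clopen subsets of the full shift are those that depend on finitely many coordinates; this form
  keeps the finite window explicit.
\<close>

definition clopen_set :: "(int \<Rightarrow> 'a) set \<Rightarrow> bool" where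
  "clopen_set U \<longleftrightarrow> (\<exists>s. \<forall>x y. agree s x y \<longrightarrow> (x \<in> U \<longleftrightarrow> y \<in> U))"

lemma clopen_setE:
  assumes "clopen_set U"
  obtains s where "\<And>x y. agree s x y \<Longrightarrow> x \<in> U \<longleftrightarrow> y \<in> U"
  using assms unfolding clopen_set_def by blast

lemma clopen_set_finite_window:
  assumes "finite I" "\<And>x y. \<forall>i\<in>I. x i = y i \<Longrightarrow> x \<in> U \<longleftrightarrow> y \<in> U"
  shows "clopen_set U"
  unfolding clopen_set_def by (metis agree_finite[OF assms(1)] assms(2))

lemma clopen_set_Compl: "clopen_set U \<Longrightarrow> clopen_set (- U)"
  by (simp add: clopen_set_def)

lemma clopen_set_Int:
  assumes "clopen_set U" "clopen_set V"
  shows "clopen_set (U \<inter> V)"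
proof -
  obtain s t where "\<And>x y. agree s x y \<Longrightarrow> x \<in> U \<longleftrightarrow> y \<in> U" "\<And>x y. agree t x y \<Longrightarrow> x \<in> V \<longleftrightarrow> y \<in> V"
    using assms by (metis clopen_setE)
  then show ?thesis
    unfolding clopen_set_def
    by (intro exI[of _ "max s t"]) (metis IntD1 IntD2 IntI agree_mono max.cobounded1 max.cobounded2)
qed

lemma clopen_set_shift_by:
  fixes U :: "(int \<Rightarrow> 'a) set"
  assumes "clopen_set U"
  shows "clopen_set {x. shift_by i x \<in> U}"
proof -
  obtain s where s: "\<And>x y. agree s x y \<Longrightarrow> x \<in> U \<longleftrightarrow> y \<in> U"
    using assms by (rule clopen_setE) blast
  obtain t where "\<And>x y :: int \<Rightarrow> 'a. agree t x y \<Longrightarrow> agree s (shift_by i x) (shift_by i y)"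
    by (rule agree_shift_by) blast
  with s show ?thesis
    unfolding clopen_set_def by blast
qed

lemma closedin_clopen_set: "clopen_set U \<Longrightarrow> closedin full_shift U"
  unfolding closedin_full_shift_iff clopen_set_def by blast

text \<open>
  The points approximated by translates \<open>shift_by i x\<close> with \<open>i\<close> in each of the sets \<open>J n\<close>. Suitable
  choices of \<open>J\<close> give the orbit closure and the two limit sets of \<open>x\<close>, which share most of their
  properties.
\<close>

definition limit_set :: "(nat \<Rightarrow> int set) \<Rightarrow> (int \<Rightarrow> 'a) \<Rightarrow> (int \<Rightarrow> 'a) set" where
  "limit_set J x = {y. \<forall>s n. \<exists>i\<in>J n. agree s y (shift_by i x)}"

abbreviation orbit_closure :: "(int \<Rightarrow> 'a) \<Rightarrow> (int \<Rightarrow> 'a) set" where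
  "orbit_closure \<equiv> limit_set (\<lambda>_. UNIV)"

abbreviation alpha_limit :: "(int \<Rightarrow> 'a) \<Rightarrow> (int \<Rightarrow> 'a) set" where
  "alpha_limit \<equiv> limit_set (\<lambda>n. {..- int n})"

abbreviation omega_limit :: "(int \<Rightarrow> 'a) \<Rightarrow> (int \<Rightarrow> 'a) set" where
  "omega_limit \<equiv> limit_set (\<lambda>n. {int n..})"

lemma subshift_limit_set:
  assumes J: "\<And>n d. \<exists>m. \<forall>i\<in>J m. d + i \<in> J n"
  shows "subshift (limit_set J x)"
proof (rule subshiftI)
  fix y assume y: "\<And>s. \<exists>z\<in>limit_set J x. agree s y z"
  show "y \<in> limit_set J x"
    unfolding limit_set_def
  proof (intro CollectI allI)
    fix s n
    obtain z where "z \<in> limit_set J x" and yz: "agree s y z"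
      using y by blast
    then obtain i where "i \<in> J n" "agree s z (shift_by i x)"
      unfolding limit_set_def by blast
    with agree_trans[OF yz] show "\<exists>i\<in>J n. agree s y (shift_by i x)"
      by blast
  qed
next
  fix y d assume y: "y \<in> limit_set J x"
  show "shift_by d y \<in> limit_set J x"
    unfolding limit_set_def
  proof (intro CollectI allI)
    fix s n
    obtain t where t: "\<And>x y :: int \<Rightarrow> 'a. agree t x y \<Longrightarrow> agree s (shift_by d x) (shift_by d y)"
      by (rule agree_shift_by) blast
    obtain m where m: "\<forall>i\<in>J m. d + i \<in> J n"
      using J by blast
    obtain i where "i \<in> J m" "agree t y (shift_by i x)"
      using y unfolding limit_set_def by blast
    with t[of y "shift_by i x"] m show "\<exists>i\<in>J n. agree s (shift_by d y) (shift_by i x)"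
      by auto
  qed
qed

lemma subshift_orbit_closure: "subshift (orbit_closure x)"
  by (rule subshift_limit_set) simp

lemma subshift_alpha_limit: "subshift (alpha_limit x)"
proof (rule subshift_limit_set)
  fix n d
  show "\<exists>m. \<forall>i\<in>{..- int m}. d + i \<in> {..- int n}"
    by (intro exI[of _ "n + nat \<bar>d\<bar>"]) auto
qed

lemma subshift_omega_limit: "subshift (omega_limit x)"
proof (rule subshift_limit_set)
  fix n d
  show "\<exists>m. \<forall>i\<in>{int m..}. d + i \<in> {int n..}"
    by (intro exI[of _ "n + nat \<bar>d\<bar>"]) auto
qed

lemma shift_by_in_orbit_closure: "shift_by i x \<in> orbit_closure x"
  by (auto simp: limit_set_def intro: agree_refl)

lemma self_in_orbit_closure: "x \<in> orbit_closure x"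
  using shift_by_in_orbit_closure[of 0 x] by simp

lemma limit_set_subset:
  assumes "subshift X" "x \<in> X"
  shows "limit_set J x \<subseteq> X"
proof
  fix y assume "y \<in> limit_set J x"
  then have "\<exists>z\<in>X. agree s y z" for s
    using subshift_shift_by[OF assms] unfolding limit_set_def by blast
  then show "y \<in> X" by (rule subshift_closed[OF assms(1)])
qed

lemma limit_set_visit:
  assumes "y \<in> limit_set J x" "y \<in> U" "clopen_set U"
  obtains i where "i \<in> J n" "shift_by i x \<in> U"
  using assms(1) clopen_setE[OF assms(3)] assms(2) unfolding limit_set_def mem_Collect_eq
  by metis

text \<open>
  Otherwise \<open>x\<close> would visit \<open>U\<close> at some time in every \<open>J n\<close>, and by compactness these visits would
  accumulate at a point of the limit set inside \<open>U\<close>.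
\<close>

lemma limit_set_avoid:
  fixes U :: "(int \<Rightarrow> 'a::finite) set"
  assumes U: "clopen_set U" "limit_set J x \<inter> U = {}" and J: "decseq J"
  obtains n where "\<And>i. i \<in> J n \<Longrightarrow> shift_by i x \<notin> U"
proof (rule ccontr)
  assume "\<not> thesis"
  then have rec: "\<exists>i\<in>J n. shift_by i x \<in> U" for n
    using that by blast
  define C where "C n = U \<inter> {y. \<exists>i\<in>J n. agree n y (shift_by i x)}" for n
  have "clopen_set {y. \<exists>i\<in>J n. agree n y (shift_by i x)}" for n
    unfolding clopen_set_def mem_Collect_eq by (meson agree_sym agree_trans)
  then have "closedin full_shift (C n)" for n
    unfolding C_def by (intro closedin_clopen_set clopen_set_Int U)
  moreover have "C n \<noteq> {}" for n
    using rec[of n] agree_refl unfolding C_def by fast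
  moreover have "decseq C"
    using J unfolding decseq_def C_def by (blast intro: agree_mono)
  ultimately obtain y where y: "\<And>n. y \<in> C n"
    by (rule decreasing_closed_nonempty) blast
  have "y \<in> limit_set J x"
    unfolding limit_set_def
  proof (intro CollectI allI)
    fix s n
    obtain i where "i \<in> J (max s n)" "agree (max s n) y (shift_by i x)"
      using y[of "max s n"] unfolding C_def by blast
    then show "\<exists>i\<in>J n. agree s y (shift_by i x)"
      using J unfolding decseq_def by (meson agree_mono max.cobounded1 max.cobounded2 subsetD)
  qed
  with y[of 0] U(2) show False
    unfolding C_def by blast
qed

section \<open>Finitely many patterns separate the subsystems\<close>

text \<open>
  A pair \<open>(f, s)\<close> stands for the finite pattern formed by the first \<open>s\<close> coordinates of \<open>f\<close>.
\<close>

definition pattern_at :: "((int \<Rightarrow> 'a) \<times> nat) set \<Rightarrow> (int \<Rightarrow> 'a) \<Rightarrow> int \<Rightarrow> bool" where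
  "pattern_at F z i \<longleftrightarrow> (\<exists>(f, s)\<in>F. agree s f (shift_by i z))"

lemma pattern_at_shift_by [simp]: "pattern_at F (shift_by j z) i \<longleftrightarrow> pattern_at F z (i + j)"
  by (simp add: pattern_at_def)

lemma clopen_set_pattern_at:
  fixes F :: "((int \<Rightarrow> 'a) \<times> nat) set"
  assumes "finite F"
  shows "clopen_set {z. pattern_at F z i}"
proof -
  have "clopen_set {z. pattern_at F z 0}"
    unfolding clopen_set_def pattern_at_def mem_Collect_eq shift_by_0
  proof (intro exI[of _ "Max (snd ` F)"] allI impI)
    fix x y :: "int \<Rightarrow> 'a" assume *: "agree (Max (snd ` F)) x y"
    have "agree s x y" if "(f, s) \<in> F" for f s
      by (rule agree_mono[OF *]) (use that assms in \<open>force intro!: Max_ge\<close>)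
    then have "agree s f x \<longleftrightarrow> agree s f y" if "(f, s) \<in> F" for f s
      using that agree_trans agree_sym by meson
    then show "(\<exists>(f, s)\<in>F. agree s f x) \<longleftrightarrow> (\<exists>(f, s)\<in>F. agree s f y)"
      by (intro bex_cong) auto
  qed
  from clopen_set_shift_by[OF this, of i] show ?thesis by simp
qed

text \<open>
  For each of the finitely many subsystems \<open>Y\<close> of \<open>X\<close> not contained in \<open>A\<close>, a point of \<open>Y\<close> outside the
  closed set \<open>A\<close> provides a pattern of \<open>Y\<close> that never occurs in \<open>A\<close>. A point of \<open>X\<close> outside \<open>A\<close> has an
  orbit closure of this kind, and therefore contains the corresponding pattern.
\<close>

lemma separating_patterns:
  fixes X :: "(int \<Rightarrow> 'a::finite) set"
  assumes X: "subshift X" "quasiminimal X" and A: "subshift A"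
  obtains F where "finite F" "\<And>z. z \<in> X \<Longrightarrow> z \<in> A \<longleftrightarrow> (\<forall>i. \<not> pattern_at F z i)"
proof -
  define \<Y> where "\<Y> = {Y. subshift Y \<and> Y \<subseteq> X \<and> \<not> Y \<subseteq> A}"
  have "\<Y> \<subseteq> insert X {Y. subshift Y \<and> Y \<subset> X}"
    by (auto simp: \<Y>_def)
  then have fin: "finite \<Y>"
    using X(2) unfolding quasiminimal_def by (meson finite.insertI finite_subset)
  have "\<exists>f s. f \<in> Y \<and> (\<forall>z\<in>A. \<not> agree s f z)" if "Y \<in> \<Y>" for Y
  proof -
    from that obtain f where "f \<in> Y" "f \<notin> A"
      by (auto simp: \<Y>_def)
    with subshift_closed[OF A, of f] show ?thesis by blast
  qed
  then obtain f s where fs: "\<And>Y. Y \<in> \<Y> \<Longrightarrow> f Y \<in> Y" "\<And>Y z. Y \<in> \<Y> \<Longrightarrow> z \<in> A \<Longrightarrow> \<not> agree (s Y) (f Y) z"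
    by metis
  show thesis
  proof (rule that)
    show "finite ((\<lambda>Y. (f Y, s Y)) ` \<Y>)"
      using fin by simp
    fix z assume "z \<in> X"
    show "z \<in> A \<longleftrightarrow> (\<forall>i. \<not> pattern_at ((\<lambda>Y. (f Y, s Y)) ` \<Y>) z i)"
    proof
      assume "z \<in> A"
      then show "\<forall>i. \<not> pattern_at ((\<lambda>Y. (f Y, s Y)) ` \<Y>) z i"
        using fs(2) subshift_shift_by[OF A] by (auto simp: pattern_at_def)
    next
      assume none: "\<forall>i. \<not> pattern_at ((\<lambda>Y. (f Y, s Y)) ` \<Y>) z i"
      show "z \<in> A"
      proof (rule ccontr)
        assume "z \<notin> A"
        then have Y: "orbit_closure z \<in> \<Y>"
          using self_in_orbit_closure[of z] subshift_orbit_closure[of z]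
            limit_set_subset[OF X(1) \<open>z \<in> X\<close>] by (auto simp: \<Y>_def)
        from fs(1)[OF Y] obtain i where "agree (s (orbit_closure z)) (f (orbit_closure z)) (shift_by i z)"
          unfolding limit_set_def by blast
        with none Y show False by (auto simp: pattern_at_def)
      qed
    qed
  qed
qed

text \<open>
  There are finitely many subsystems that do not contain \<open>x\<close>, and they are closed, so some neighbourhood
  of \<open>x\<close> misses them all. If \<open>y\<close> is in this neighbourhood then its orbit closure contains \<open>x\<close>.
\<close>

lemma generic_neighbourhood:
  fixes X :: "(int \<Rightarrow> 'a::finite) set"
  assumes X: "subshift X" "quasiminimal X" and x: "x \<in> X"
  obtains t where "\<And>y. y \<in> orbit_closure x \<Longrightarrow> agree t x y \<Longrightarrow> orbit_closure y = orbit_closure x"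
proof -
  define \<Y> where "\<Y> = {Y. subshift Y \<and> Y \<subseteq> X \<and> x \<notin> Y}"
  have "\<Y> \<subseteq> {Y. subshift Y \<and> Y \<subset> X}"
    using x by (auto simp: \<Y>_def)
  then have fin: "finite \<Y>"
    using X(2) unfolding quasiminimal_def by (rule finite_subset)
  have "\<exists>s. \<forall>y\<in>Y. \<not> agree s x y" if "Y \<in> \<Y>" for Y
    using that subshift_closed[of Y x] by (auto simp: \<Y>_def)
  then obtain s where s: "\<And>Y y. Y \<in> \<Y> \<Longrightarrow> y \<in> Y \<Longrightarrow> \<not> agree (s Y) x y"
    by metis
  have "orbit_closure y = orbit_closure x"
    if y: "y \<in> orbit_closure x" "agree (Max (s ` \<Y>)) x y" for y
  proof -
    have sub: "orbit_closure y \<subseteq> orbit_closure x"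
      by (rule limit_set_subset[OF subshift_orbit_closure y(1)])
    have "x \<in> orbit_closure y"
    proof (rule ccontr)
      assume "x \<notin> orbit_closure y"
      then have Y: "orbit_closure y \<in> \<Y>"
        using sub limit_set_subset[OF X(1) x] subshift_orbit_closure by (auto simp: \<Y>_def)
      then have "agree (s (orbit_closure y)) x y"
        using fin by (intro agree_mono[OF y(2)]) simp
      with s[OF Y self_in_orbit_closure] show False by blast
    qed
    then have "orbit_closure x \<subseteq> orbit_closure y"
      by (rule limit_set_subset[OF subshift_orbit_closure])
    with sub show ?thesis by blast
  qed
  then show thesis by (rule that)
qed

text \<open>
  By compactness the distance at which a pattern occurs is uniform.
\<close>

lemma pattern_bound:
  fixes C :: "(int \<Rightarrow> 'a::finite) set"
  assumes C: "closedin full_shift C" and F: "finite F"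
    and ex: "\<And>y. y \<in> C \<Longrightarrow> \<exists>i. pattern_at F y i"
  obtains N where "\<And>y. y \<in> C \<Longrightarrow> \<exists>i<N. pattern_at F y (int_decode i)"
proof (rule ccontr)
  assume "\<not> thesis"
  then have neg: "\<exists>y\<in>C. \<forall>i<N. \<not> pattern_at F y (int_decode i)" for N
    using that by blast
  define D where "D N = C \<inter> {y. \<forall>i<N. \<not> pattern_at F y (int_decode i)}" for N :: nat
  have "clopen_set {y. \<forall>i<N. \<not> pattern_at F y (int_decode i)}" for N
  proof (induction N)
    case 0
    show ?case by (simp add: clopen_set_def)
  next
    case (Suc N)
    have "{y. \<forall>i<Suc N. \<not> pattern_at F y (int_decode i)} =
        {y. \<forall>i<N. \<not> pattern_at F y (int_decode i)} \<inter> - {y. pattern_at F y (int_decode N)}"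
      by (auto simp: less_Suc_eq)
    then show ?case
      by (simp add: clopen_set_Int[OF Suc] clopen_set_Compl clopen_set_pattern_at F)
  qed
  then have "closedin full_shift (D N)" for N
    unfolding D_def by (intro closedin_Int C closedin_clopen_set)
  moreover have "D N \<noteq> {}" for N
    using neg[of N] by (auto simp: D_def)
  moreover have "decseq D"
    by (auto simp: decseq_def D_def)
  ultimately obtain y where y: "\<And>N. y \<in> D N"
    by (rule decreasing_closed_nonempty) blast
  from y[of 0] ex obtain i where "pattern_at F y i"
    by (auto simp: D_def)
  with y[of "Suc (int_encode i)"] show False
    by (auto simp: D_def)
qed

section \<open>Halting inside an orbit closure\<close>

lemma halts_iff_ex: "halts X U V \<longleftrightarrow> (\<exists>x\<in>X. \<exists>n::nat. x \<in> U \<and> shift_by (int n) x \<in> V)"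
  by (simp add: halts_def shift_map_funpow)

lemma halts_orbit_closure_visit:
  assumes "clopen_set U" "clopen_set V" "y \<in> orbit_closure x" "y \<in> U" "shift_by (int n) y \<in> V"
  obtains i where "shift_by i x \<in> U" "shift_by (i + int n) x \<in> V"
proof -
  have "clopen_set (U \<inter> {y. shift_by (int n) y \<in> V})"
    by (intro clopen_set_Int clopen_set_shift_by assms)
  from limit_set_visit[OF assms(3) _ this] assms(4,5)
  obtain i where "shift_by i x \<in> U \<inter> {y. shift_by (int n) y \<in> V}"
    by blast
  then show thesis by (intro that[of i]) (auto simp: add.commute)
qed

text \<open>
  By density, a halting instance with delay \<open>n\<close> anywhere in the orbit closure is seen along the orbit of
  each point whose orbit closure is the same. So it may be demanded of all such points near \<open>x\<close>,
  which replaces the existence of a point by a universal statement about points.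
\<close>

lemma halts_orbit_closure_iff:
  assumes t: "\<And>y. y \<in> orbit_closure x \<Longrightarrow> agree t x y \<Longrightarrow> orbit_closure y = orbit_closure x"
    and UV: "clopen_set U" "clopen_set V"
  shows "halts (orbit_closure x) U V \<longleftrightarrow>
    (\<exists>n::nat. \<forall>y. y \<notin> orbit_closure x \<or> \<not> agree t x y \<or>
      (\<exists>i. shift_by i y \<in> U \<and> shift_by (i + int n) y \<in> V))" (is "?L \<longleftrightarrow> ?R")
proof
  assume ?L
  then obtain z n where z: "z \<in> orbit_closure x" "z \<in> U" "shift_by (int n) z \<in> V"
    by (auto simp: halts_iff_ex)
  have "\<exists>i. shift_by i y \<in> U \<and> shift_by (i + int n) y \<in> V"
    if "y \<in> orbit_closure x" "agree t x y" for y
    using halts_orbit_closure_visit[OF UV z(1)[folded t[OF that]] z(2,3)] by blast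
  then show ?R by blast
next
  assume ?R
  then obtain n i where "shift_by i x \<in> U" "shift_by (int n) (shift_by i x) \<in> V"
    using self_in_orbit_closure[of x] by (metis add.commute agree_refl shift_by_shift_by)
  then show ?L
    unfolding halts_iff_ex using shift_by_in_orbit_closure[of i x] by blast
qed

text \<open>
  Visits of \<open>x\<close> to \<open>U\<close> are bounded from the left and visits to \<open>V\<close> from the right in terms of \<open>N\<close>: the
  patterns in \<open>F\<close> do not occur in the \<open>\<alpha>\<close>-limit set and so are absent from \<open>x\<close> to the left of some
  \<open>- p\<close>, while each visit to \<open>U\<close> is within distance \<open>N\<close> of such a pattern; likewise for \<open>G\<close>, the
  \<open>\<omega>\<close>-limit set and some \<open>q\<close>. A visit to \<open>U\<close> followed by one to \<open>V\<close> then has delay less than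
  \<open>p + q + 2 * N\<close>, which leaves finitely many delays to exclude. Each clause on the right is a
  universal statement about an open condition on \<open>y\<close>, ready for \<open>semidecidable_all\<close>.
\<close>

lemma not_halts_orbit_closure_iff:
  fixes X :: "(int \<Rightarrow> 'a::finite) set"
  assumes X: "subshift X" "quasiminimal X" and x: "x \<in> X"
  obtains F G c where "finite F" "finite G"
    "\<And>U V. clopen_set U \<Longrightarrow> clopen_set V \<Longrightarrow>
      \<not> halts (orbit_closure x) U V \<longleftrightarrow>
        (\<forall>y. y \<notin> orbit_closure x \<or> y \<notin> U) \<or> (\<forall>y. y \<notin> orbit_closure x \<or> y \<notin> V) \<or>
        (\<exists>N. (\<forall>y. y \<notin> orbit_closure x \<or> y \<notin> U \<or> (\<exists>i<N. pattern_at F y (int_decode i))) \<and>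
             (\<forall>y. y \<notin> orbit_closure x \<or> y \<notin> V \<or> (\<exists>i<N. pattern_at G y (int_decode i))) \<and>
             (\<forall>n<c + 2 * N. \<forall>y. y \<notin> orbit_closure x \<or> y \<notin> U \<or> shift_by (int n) y \<notin> V))"
proof -
  let ?Z = "orbit_closure x"
  have ZX: "?Z \<subseteq> X"
    by (rule limit_set_subset[OF X(1) x])
  obtain F where F: "finite F" "\<And>z. z \<in> X \<Longrightarrow> z \<in> alpha_limit x \<longleftrightarrow> (\<forall>i. \<not> pattern_at F z i)"
    by (rule separating_patterns[OF X subshift_alpha_limit]) blast
  obtain G where G: "finite G" "\<And>z. z \<in> X \<Longrightarrow> z \<in> omega_limit x \<longleftrightarrow> (\<forall>i. \<not> pattern_at G z i)"
    by (rule separating_patterns[OF X subshift_omega_limit]) blast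
  have "alpha_limit x \<inter> {z. pattern_at F z 0} = {}"
    using F(2) limit_set_subset[OF X(1) x] by blast
  then obtain p where p: "\<And>i. i \<in> {..- int p} \<Longrightarrow> shift_by i x \<notin> {z. pattern_at F z 0}"
    by (rule limit_set_avoid[OF clopen_set_pattern_at[OF F(1)]]) (auto simp: decseq_def)
  have "omega_limit x \<inter> {z. pattern_at G z 0} = {}"
    using G(2) limit_set_subset[OF X(1) x] by blast
  then obtain q where q: "\<And>i. i \<in> {int q..} \<Longrightarrow> shift_by i x \<notin> {z. pattern_at G z 0}"
    by (rule limit_set_avoid[OF clopen_set_pattern_at[OF G(1)]]) (auto simp: decseq_def)
  show thesis
  proof (rule that[OF F(1) G(1), of "p + q"])
    fix U V :: "(int \<Rightarrow> 'a) set"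
    assume UV: "clopen_set U" "clopen_set V"
    let ?boundU = "\<lambda>N. \<forall>y. y \<notin> ?Z \<or> y \<notin> U \<or> (\<exists>i<N. pattern_at F y (int_decode i))"
    let ?boundV = "\<lambda>N. \<forall>y. y \<notin> ?Z \<or> y \<notin> V \<or> (\<exists>i<N. pattern_at G y (int_decode i))"
    let ?short = "\<lambda>N. \<forall>n<p + q + 2 * N. \<forall>y. y \<notin> ?Z \<or> y \<notin> U \<or> shift_by (int n) y \<notin> V"
    let ?noU = "\<forall>y. y \<notin> ?Z \<or> y \<notin> U" and ?noV = "\<forall>y. y \<notin> ?Z \<or> y \<notin> V"
    show "\<not> halts ?Z U V \<longleftrightarrow> ?noU \<or> ?noV \<or> (\<exists>N. ?boundU N \<and> ?boundV N \<and> ?short N)"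
    proof
      assume nh: "\<not> halts ?Z U V"
      show "?noU \<or> ?noV \<or> (\<exists>N. ?boundU N \<and> ?boundV N \<and> ?short N)"
      proof (rule ccontr)
        assume neg: "\<not> (?noU \<or> ?noV \<or> (\<exists>N. ?boundU N \<and> ?boundV N \<and> ?short N))"
        then obtain u v where "u \<in> ?Z" "u \<in> U" "v \<in> ?Z" "v \<in> V" by blast
        then obtain k l where k: "shift_by k x \<in> U" and l: "shift_by l x \<in> V"
          using limit_set_visit UV by metis
        \<comment> \<open>Without halting, every visit of \<open>x\<close> to \<open>V\<close> precedes every visit to \<open>U\<close>. A visit to \<open>V\<close> at time
          \<open>l\<close> thus bounds the visits to \<open>U\<close> from the left, and one to \<open>U\<close> at time \<open>k\<close> those to \<open>V\<close> from the
          right.\<close>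
        have order: "j < i" if "shift_by i x \<in> U" "shift_by j x \<in> V" for i j
        proof (rule ccontr)
          assume "\<not> j < i"
          then have "shift_by (int (nat (j - i))) (shift_by i x) \<in> V"
            using that(2) by simp
          with that(1) nh shift_by_in_orbit_closure[of i x] show False
            unfolding halts_iff_ex by blast
        qed
        have "y \<notin> alpha_limit x" if "y \<in> U" for y
        proof
          assume "y \<in> alpha_limit x"
          from limit_set_visit[OF this that UV(1), of "nat \<bar>l\<bar>"]
          obtain i where "i \<le> - \<bar>l\<bar>" "shift_by i x \<in> U" by auto
          with order[OF this(2) l] show False by linarith
        qed
        then have "\<exists>i. pattern_at F y i" if "y \<in> ?Z \<inter> U" for y
          using F(2)[of y] that ZX by blast
        from pattern_bound[OF closedin_Int[OF _ closedin_clopen_set[OF UV(1)]] F(1) this]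
        obtain M where M: "\<And>y. y \<in> ?Z \<inter> U \<Longrightarrow> \<exists>i<M. pattern_at F y (int_decode i)"
          using subshift_orbit_closure[of x] unfolding subshift_def by blast
        have "y \<notin> omega_limit x" if "y \<in> V" for y
        proof
          assume "y \<in> omega_limit x"
          from limit_set_visit[OF this that UV(2), of "nat \<bar>k\<bar>"]
          obtain i where "\<bar>k\<bar> \<le> i" "shift_by i x \<in> V" by auto
          with order[OF k this(2)] show False by linarith
        qed
        then have "\<exists>i. pattern_at G y i" if "y \<in> ?Z \<inter> V" for y
          using G(2)[of y] that ZX by blast
        from pattern_bound[OF closedin_Int[OF _ closedin_clopen_set[OF UV(2)]] G(1) this]
        obtain M' where M': "\<And>y. y \<in> ?Z \<inter> V \<Longrightarrow> \<exists>i<M'. pattern_at G y (int_decode i)"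
          using subshift_orbit_closure[of x] unfolding subshift_def by blast
        have "?boundU (max M M')"
          using M by (meson IntI less_max_iff_disj)
        moreover have "?boundV (max M M')"
          using M' by (meson IntI less_max_iff_disj)
        moreover have "?short (max M M')"
          using nh unfolding halts_iff_ex by blast
        ultimately show False using neg by blast
      qed
    next
      assume "?noU \<or> ?noV \<or> (\<exists>N. ?boundU N \<and> ?boundV N \<and> ?short N)"
      then show "\<not> halts ?Z U V"
      proof (elim disjE exE conjE)
        assume ?noU
        then show ?thesis by (auto simp: halts_iff_ex)
      next
        assume ?noV
        then show ?thesis
          using subshift_shift_by[OF subshift_orbit_closure] by (auto simp: halts_iff_ex)
      next
        fix N assume N: "?boundU N" "?boundV N" "?short N"
        show ?thesis
        proof
          assume "halts ?Z U V"
          then obtain y n where y: "y \<in> ?Z" "y \<in> U" "shift_by (int n) y \<in> V"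
            by (auto simp: halts_iff_ex)
          obtain i where i: "shift_by i x \<in> U" "shift_by (i + int n) x \<in> V"
            by (rule halts_orbit_closure_visit[OF UV y])
          obtain a where a: "a < N" "pattern_at F x (int_decode a + i)"
            using N(1) i(1) shift_by_in_orbit_closure[of i x] by auto
          obtain b where b: "b < N" "pattern_at G x (int_decode b + (i + int n))"
            using N(2) i(2) shift_by_in_orbit_closure[of "i + int n" x] by auto
          have "- int p < int_decode a + i"
            using p[of "int_decode a + i"] a(2) by fastforce
          moreover have "int_decode b + (i + int n) < int q"
            using q[of "int_decode b + (i + int n)"] b(2) by fastforce
          ultimately have "n < p + q + 2 * N"
            using abs_int_decode_le[of a] abs_int_decode_le[of b] a(1) b(1) by linarith
          with N(3) y show False by blast
        qed
      qed
    qed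
  qed
qed

section \<open>Codes of clopen sets\<close>

text \<open>
  Every number is given a meaning as the code of a clopen set, whether or not its list entries are
  words of a common length over the alphabet. Halting is thus semidecided uniformly in the codes, and
  well-formedness of the input is a separate, decidable test.
\<close>

definition coded_clopen :: "nat \<Rightarrow> (int \<Rightarrow> 'a::finite) set" where
  "coded_clopen c = {x. \<exists>m<code_length (psnd c). \<forall>k<code_length (code_nth (psnd c) m).
     to_nat (x (int_decode (pfst c) + int k)) = code_nth (code_nth (psnd c) m) k}"

lemma code_length_word_code [simp]: "code_length (word_code w) = length w"
  by (simp add: word_code_def)

lemma code_nth_word_code [simp]: "k < length w \<Longrightarrow> code_nth (word_code w) k = to_nat (w ! k)"
  by (simp add: word_code_def)

lemma subword_eq_iff: "subword x i (length w) = w \<longleftrightarrow> (\<forall>k<length w. x (i + int k) = w ! k)"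
  unfolding subword_def list_eq_iff_nth_eq by simp

lemma coded_clopen_clopen_code: "coded_clopen (clopen_code a C) = clopen a C"
proof -
  have "x \<in> coded_clopen (clopen_code a C) \<longleftrightarrow>
      (\<exists>m<length C. \<forall>k<length (C ! m). x (a + int k) = C ! m ! k)" for x
    by (simp add: coded_clopen_def clopen_code_def cong: conj_cong imp_cong)
  moreover have "(\<exists>w\<in>set C. P w) \<longleftrightarrow> (\<exists>m<length C. P (C ! m))" for P
    by (metis in_set_conv_nth)
  ultimately show ?thesis
    by (simp add: set_eq_iff clopen_def subword_eq_iff)
qed

lemma clopen_set_coded_clopen: "clopen_set (coded_clopen c)"
proof (rule clopen_set_finite_window)
  let ?I = "\<Union>m<code_length (psnd c).
    (\<lambda>k. int_decode (pfst c) + int k) ` {..<code_length (code_nth (psnd c) m)}"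
  show "finite ?I" by simp
  show "x \<in> coded_clopen c \<longleftrightarrow> y \<in> coded_clopen c" if "\<forall>i\<in>?I. x i = y i" for x y :: "int \<Rightarrow> 'a"
    using that by (auto simp: coded_clopen_def)
qed

text \<open>
  \<open>A\<close> is the set of codes of letters. Comparing all lengths with that of the first word expresses that
  the words have a common length.
\<close>

definition valid_code :: "nat set \<Rightarrow> nat \<Rightarrow> bool" where
  "valid_code A c \<longleftrightarrow> (\<forall>m<code_length (psnd c).
     (\<forall>k<code_length (code_nth (psnd c) m). code_nth (code_nth (psnd c) m) k \<in> A) \<and>
     code_length (code_nth (psnd c) m) = code_length (code_nth (psnd c) 0))"

lemma decidable_pred_valid_code:
  assumes "finite A" "computable a"
  shows "decidable_pred (\<lambda>e. valid_code A (a e))"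
  unfolding valid_code_def
  by (intro decidable_pred_intros computable_comp[OF assms(2)] computable_intros assms(1))

lemma valid_code_iff:
  "valid_code (range (to_nat :: 'a::finite \<Rightarrow> nat)) c \<longleftrightarrow>
     (\<exists>a (C :: 'a list list). c = clopen_code a C \<and> common_length C)"
proof
  assume valid: "valid_code (range (to_nat :: 'a \<Rightarrow> nat)) c"
  define L where "L = list_decode (psnd c)"
  define C :: "'a list list" where "C = map (\<lambda>w. map from_nat (list_decode w)) L"
  have L: "code_length (psnd c) = length L" "\<And>m. m < length L \<Longrightarrow> code_nth (psnd c) m = L ! m"
    by (simp_all add: L_def code_length_def code_nth_def)
  have entry: "word_code (map from_nat (list_decode w) :: 'a list) = w"
    and len: "code_length w = code_length (code_nth (psnd c) 0)" if "w \<in> set L" for w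
  proof -
    obtain m where m: "m < length L" "w = L ! m"
      using \<open>w \<in> set L\<close> by (auto simp: in_set_conv_nth)
    then have *: "\<forall>k<code_length w. code_nth w k \<in> range (to_nat :: 'a \<Rightarrow> nat)"
      and "code_length w = code_length (code_nth (psnd c) 0)"
      using valid L by (auto simp: valid_code_def)
    then show "code_length w = code_length (code_nth (psnd c) 0)" by simp
    have "to_nat (from_nat y :: 'a) = y" if "y \<in> set (list_decode w)" for y
    proof -
      have "y \<in> range (to_nat :: 'a \<Rightarrow> nat)"
        using that * by (auto simp: in_set_conv_nth code_length_def code_nth_def)
      then show ?thesis by auto
    qed
    then have "map (to_nat \<circ> (from_nat :: nat \<Rightarrow> 'a)) (list_decode w) = list_decode w"
      by (intro map_idI) simp
    then show "word_code (map from_nat (list_decode w) :: 'a list) = w"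
      by (simp add: word_code_def)
  qed
  have "map word_code C = L"
    unfolding C_def map_map by (intro map_idI) (simp add: entry)
  then have "c = clopen_code (int_decode (pfst c)) C"
    by (simp add: clopen_code_def L_def)
  moreover have "common_length C"
    unfolding common_length_def C_def using len
    by (intro exI[of _ "code_length (code_nth (psnd c) 0)"]) (auto simp: code_length_def)
  ultimately show "\<exists>a (C :: 'a list list). c = clopen_code a C \<and> common_length C"
    by blast
next
  assume "\<exists>a (C :: 'a list list). c = clopen_code a C \<and> common_length C"
  then obtain a and C :: "'a list list" where c: "c = clopen_code a C" and "common_length C"
    by blast
  then obtain n where "\<forall>w\<in>set C. length w = n"
    unfolding common_length_def by blast
  then have "length (C ! m) = n" if "m < length C" for m
    using that by simp
  moreover have "0 < length C" if "m < length C" for m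
    using that by linarith
  ultimately show "valid_code (range (to_nat :: 'a \<Rightarrow> nat)) c"
    unfolding c by (fastforce simp: valid_code_def clopen_code_def)
qed

lemma halting_problem_eq:
  fixes X :: "(int \<Rightarrow> 'a::finite) set"
  shows "halting_problem X = {e. valid_code (range (to_nat :: 'a \<Rightarrow> nat)) (pfst e) \<and>
    valid_code (range (to_nat :: 'a \<Rightarrow> nat)) (psnd e) \<and>
    halts X (coded_clopen (pfst e)) (coded_clopen (psnd e))}" (is "_ = ?R")
proof
  show "halting_problem X \<subseteq> ?R"
  proof
    fix e assume "e \<in> halting_problem X"
    then obtain a C b D where e: "e = prod_encode (clopen_code a C, clopen_code b D)"
      and *: "common_length C" "common_length D" "halts X (clopen a C) (clopen b D)"
      unfolding halting_problem_def by blast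
    show "e \<in> ?R"
      using * unfolding e valid_code_iff by (auto simp: coded_clopen_clopen_code)
  qed
  show "?R \<subseteq> halting_problem X"
  proof
    fix e assume e: "e \<in> ?R"
    then obtain a b and C D :: "'a list list"
      where C: "pfst e = clopen_code a C" "common_length C"
        and D: "psnd e = clopen_code b D" "common_length D"
      unfolding mem_Collect_eq valid_code_iff by blast
    with e have "halts X (clopen a C) (clopen b D)"
      by (simp add: coded_clopen_clopen_code)
    moreover have "e = prod_encode (clopen_code a C, clopen_code b D)"
      unfolding C(1)[symmetric] D(1)[symmetric] by simp
    ultimately show "e \<in> halting_problem X"
      using C(2) D(2) by (simp add: halting_problem_iff)
  qed
qed

section \<open>Semideciding the halting relation\<close>

lemma semidecidable_coded_clopen:
  assumes a: "computable a" and i: "computable i"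
  shows "semidecidable (\<lambda>e (x :: int \<Rightarrow> 'a::finite). shift_by (int_decode (i e)) x \<in> coded_clopen (a e))"
    and "semidecidable (\<lambda>e (x :: int \<Rightarrow> 'a::finite). shift_by (int_decode (i e)) x \<notin> coded_clopen (a e))"
proof -
  have eq: "shift_by (int_decode i) x (int_decode p + int k) =
      x (int_decode (int_code_add (int_code_add p (2 * k)) i))" for i p k and x :: "int \<Rightarrow> 'a"
    by (simp add: shift_by_def int_decode_even)
  show "semidecidable (\<lambda>e (x :: int \<Rightarrow> 'a). shift_by (int_decode (i e)) x \<in> coded_clopen (a e))"
    unfolding coded_clopen_def mem_Collect_eq eq
    by (intro semidecidable_intros semidecidable_decidable decidable_pred_intros
        computable_comp[OF a] computable_comp[OF i] computable_intros)
  show "semidecidable (\<lambda>e (x :: int \<Rightarrow> 'a). shift_by (int_decode (i e)) x \<notin> coded_clopen (a e))"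
    unfolding coded_clopen_def mem_Collect_eq eq not_ex de_Morgan_conj not_all not_imp
      imp_conv_disj[symmetric]
    by (intro semidecidable_intros semidecidable_decidable decidable_pred_intros
        computable_comp[OF a] computable_comp[OF i] computable_intros)
qed

lemma semidecidable_pattern_at:
  assumes "finite F" "computable i"
  shows "semidecidable (\<lambda>e (x :: int \<Rightarrow> 'a::finite). pattern_at F x (int_decode (i e)))"
proof -
  have eq: "pattern_at F x (int_decode i) \<longleftrightarrow>
    (\<exists>p\<in>F. \<forall>n\<in>{..<snd p}. to_nat (x (int_decode (int_code_add n i))) = to_nat (fst p (int_decode n)))"
    for x :: "int \<Rightarrow> 'a" and i
    unfolding pattern_at_def agree_def shift_by_def by (rule bex_cong) (auto simp: split_beta)
  show ?thesis
    unfolding eq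
    by (intro semidecidable_finite_disj semidecidable_finite_conj assms(1) finite_lessThan
        semidecidable_letter_eq computable_intros assms(2))
qed

lemma semidecidable_disagree:
  "semidecidable (\<lambda>e y. \<not> agree t (x :: int \<Rightarrow> 'a::finite) y)"
proof -
  have eq: "\<not> agree t x y \<longleftrightarrow> (\<exists>n\<in>{..<t}. to_nat (y (int_decode n)) \<noteq> to_nat (x (int_decode n)))" for y
    by (simp add: agree_def Bex_def) metis
  show ?thesis
    unfolding eq by (intro semidecidable_finite_disj finite_lessThan semidecidable_letter_neq computable_intros)
qed

text \<open>
  A point lies outside \<open>X\<close> iff some word that occurs in it is not in the language of \<open>X\<close>.
\<close>

lemma semidecidable_notin_Pi01:
  assumes X: "subshift X" "Pi01 X"
  shows "semidecidable (\<lambda>e (x :: int \<Rightarrow> 'a::finite). x \<notin> X)"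
proof -
  let ?B = "word_code ` (- language X)"
  have eq: "x \<notin> X \<longleftrightarrow> (\<exists>c. c \<in> ?B \<and> (\<exists>i. \<forall>k<code_length c.
      to_nat (x (int_decode (int_code_add i (2 * k)))) = code_nth c k))" for x
  proof
    assume "x \<notin> X"
    then obtain s where s: "\<And>y. y \<in> X \<Longrightarrow> \<not> agree s x y"
      using subshift_closed[OF X(1)] by blast
    \<comment> \<open>The window from \<open>- s\<close> to \<open>s\<close> contains the first \<open>s\<close> coordinates, since
      \<open>int_decode\<close> does not increase absolute values.\<close>
    define w where "w = subword x (- int s) (2 * s + 1)"
    have len: "length w = 2 * s + 1"
      by (simp add: w_def subword_def)
    have "w \<notin> language X"
    proof
      assume "w \<in> language X"
      then obtain y j n where y: "y \<in> X" "w = subword y j n"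
        unfolding language_def by blast
      then have n: "n = 2 * s + 1"
        using len by (simp add: subword_def)
      have yx: "y (j + int k) = x (- int s + int k)" if "k < 2 * s + 1" for k
      proof -
        have "w ! k = y (j + int k)"
          using that unfolding y(2) n by (simp add: subword_def del: upt_Suc)
        moreover have "w ! k = x (- int s + int k)"
          using that unfolding w_def by (simp add: subword_def del: upt_Suc)
        ultimately show ?thesis by simp
      qed
      have "agree s x (shift_by (j + int s) y)"
        unfolding agree_def
      proof (intro allI impI)
        fix m assume "m < s"
        then have "\<bar>int_decode m\<bar> < int s"
          using abs_int_decode_le[of m] by linarith
        then obtain k where "int k = int_decode m + int s" "k < 2 * s + 1"
          by (intro that[of "nat (int_decode m + int s)"]) auto
        with yx[of k] show "x (int_decode m) = shift_by (j + int s) y (int_decode m)"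
          by (simp add: shift_by_def algebra_simps)
      qed
      with s subshift_shift_by[OF X(1) y(1)] show False by blast
    qed
    moreover have "\<forall>k<length w. to_nat (x (int_decode (int_code_add (int_encode (- int s)) (2 * k)))) =
        code_nth (word_code w) k"
      by (simp add: int_decode_even) (simp add: w_def subword_def del: upt_Suc)
    ultimately show "\<exists>c. c \<in> ?B \<and> (\<exists>i. \<forall>k<code_length c.
      to_nat (x (int_decode (int_code_add i (2 * k)))) = code_nth c k)"
      by (intro exI[of _ "word_code w"] conjI exI[of _ "int_encode (- int s)"]) auto
  next
    assume "\<exists>c. c \<in> ?B \<and> (\<exists>i. \<forall>k<code_length c.
      to_nat (x (int_decode (int_code_add i (2 * k)))) = code_nth c k)"
    then obtain w i where w: "w \<notin> language X"
      and i: "\<forall>k<length w. x (int_decode i + int k) = w ! k"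
      by (auto simp: int_decode_even)
    from i have "subword x (int_decode i) (length w) = w"
      by (simp add: subword_eq_iff)
    moreover have "subword x (int_decode i) (length w) \<in> language X" if "x \<in> X"
      using that unfolding language_def by blast
    ultimately show "x \<notin> X"
      using w by auto
  qed
  have "recursively_enumerable ?B"
    using X(2) by (simp add: Pi01_def)
  then show ?thesis
    unfolding eq
    by (intro semidecidable_intros semidecidable_recursively_enumerable computable_intros)
qed

text \<open>
  A point of \<open>X\<close> outside \<open>Z\<close> reveals itself by one of the patterns separating \<open>Z\<close>.
\<close>

lemma semidecidable_notin_subsystem:
  assumes X: "subshift X" "quasiminimal X" "Pi01 X" and Z: "subshift Z" "Z \<subseteq> X"
  shows "semidecidable (\<lambda>e (x :: int \<Rightarrow> 'a::finite). x \<notin> Z)"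
proof -
  obtain F where F: "finite F" "\<And>x. x \<in> X \<Longrightarrow> x \<in> Z \<longleftrightarrow> (\<forall>i. \<not> pattern_at F x i)"
    by (rule separating_patterns[OF X(1,2) Z(1)]) blast
  have eq: "x \<notin> Z \<longleftrightarrow> x \<notin> X \<or> (\<exists>n. pattern_at F x (int_decode n))" for x
    unfolding ex_int_decode[symmetric] using F(2) Z(2) by blast
  show ?thesis
    unfolding eq
    by (intro semidecidable_intros semidecidable_notin_Pi01 X semidecidable_pattern_at F(1) computable_intros)
qed

lemma semidecidable_halts_orbit_closure:
  fixes X :: "(int \<Rightarrow> 'a::finite) set"
  assumes X: "subshift X" "quasiminimal X" "Pi01 X" and x: "x \<in> X"
  shows "semidecidable (\<lambda>e (y :: int \<Rightarrow> 'a).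
      halts (orbit_closure x) (coded_clopen (pfst e)) (coded_clopen (psnd e)))"
    and "semidecidable (\<lambda>e (y :: int \<Rightarrow> 'a).
      \<not> halts (orbit_closure x) (coded_clopen (pfst e)) (coded_clopen (psnd e)))"
proof -
  have notin: "semidecidable (\<lambda>e (y :: int \<Rightarrow> 'a). y \<notin> orbit_closure x)"
    by (rule semidecidable_notin_subsystem[OF X subshift_orbit_closure limit_set_subset[OF X(1) x]])
  have shift_add: "shift_by (int_decode i + int n) = shift_by (int_decode (int_code_add i (2 * n)))" for i n
    by (simp add: int_decode_even)
  have shift_nat: "shift_by (int n) = shift_by (int_decode (2 * n))" for n
    by (simp add: int_decode_even)
  have unshifted: "semidecidable (\<lambda>e (y :: int \<Rightarrow> 'a). y \<notin> coded_clopen (a e))" if "computable a" for a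
    using semidecidable_coded_clopen(2)[OF that computable_const[of 0]]
      int_decode_even[of 0] by simp
  obtain t where t: "\<And>y. y \<in> orbit_closure x \<Longrightarrow> agree t x y \<Longrightarrow> orbit_closure y = orbit_closure x"
    by (rule generic_neighbourhood[OF X(1,2) x]) blast
  have halts_eq: "halts (orbit_closure x) U V \<longleftrightarrow>
    (\<exists>n::nat. \<forall>y. y \<notin> orbit_closure x \<or> \<not> agree t x y \<or>
      (\<exists>i. shift_by (int_decode i) y \<in> U \<and> shift_by (int_decode (int_code_add i (2 * n))) y \<in> V))"
    if "clopen_set U" "clopen_set V" for U V
  proof -
    have "halts (orbit_closure x) U V \<longleftrightarrow>
      (\<exists>n::nat. \<forall>y. y \<notin> orbit_closure x \<or> \<not> agree t x y \<or>
        (\<exists>i. shift_by i y \<in> U \<and> shift_by (i + int n) y \<in> V))"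
      by (rule halts_orbit_closure_iff[OF _ that]) (rule t)
    then show ?thesis
      by (simp only: ex_int_decode shift_add)
  qed
  show "semidecidable (\<lambda>e (y :: int \<Rightarrow> 'a).
      halts (orbit_closure x) (coded_clopen (pfst e)) (coded_clopen (psnd e)))"
    unfolding halts_eq[OF clopen_set_coded_clopen clopen_set_coded_clopen]
    by (intro semidecidable_ex semidecidable_all semidecidable_disj semidecidable_conj
        notin semidecidable_disagree semidecidable_coded_clopen computable_intros)
  obtain F G c where F: "finite F" and G: "finite G" and
    eq: "\<And>U V. clopen_set U \<Longrightarrow> clopen_set V \<Longrightarrow>
      \<not> halts (orbit_closure x) U V \<longleftrightarrow>
        (\<forall>y. y \<notin> orbit_closure x \<or> y \<notin> U) \<or> (\<forall>y. y \<notin> orbit_closure x \<or> y \<notin> V) \<or>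
        (\<exists>N. (\<forall>y. y \<notin> orbit_closure x \<or> y \<notin> U \<or> (\<exists>i<N. pattern_at F y (int_decode i))) \<and>
             (\<forall>y. y \<notin> orbit_closure x \<or> y \<notin> V \<or> (\<exists>i<N. pattern_at G y (int_decode i))) \<and>
             (\<forall>n<c + 2 * N. \<forall>y. y \<notin> orbit_closure x \<or> y \<notin> U \<or> shift_by (int n) y \<notin> V))"
    by (rule not_halts_orbit_closure_iff[OF X(1,2) x]) blast
  show "semidecidable (\<lambda>e (y :: int \<Rightarrow> 'a).
      \<not> halts (orbit_closure x) (coded_clopen (pfst e)) (coded_clopen (psnd e)))"
    unfolding eq[OF clopen_set_coded_clopen clopen_set_coded_clopen] shift_nat
    by (intro semidecidable_intros semidecidable_all notin unshifted semidecidable_coded_clopen(2)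
        semidecidable_pattern_at F G semidecidable_decidable decidable_pred_less computable_intros)
qed

text \<open>
  A halting instance at a point of \<open>X\<close> already takes place in the orbit closure of that point.
\<close>

lemma halts_iff_orbit_closure:
  assumes "subshift X"
  shows "halts X U V \<longleftrightarrow> (\<exists>Z\<in>orbit_closure ` X. halts Z U V)"
  unfolding halts_def using self_in_orbit_closure limit_set_subset[OF assms] by blast

theorem corollary2:
  fixes X :: "(int \<Rightarrow> 'a::finite) set"
  assumes "subshift X"
    and "quasiminimal X"
    and "Pi01 X"
  shows "decidable (halting_problem X)"
proof -
  let ?A = "range (to_nat :: 'a \<Rightarrow> nat)"
  let ?valid = "\<lambda>e. valid_code ?A (pfst e) \<and> valid_code ?A (psnd e)"
  let ?halts = "\<lambda>Z e. halts Z (coded_clopen (pfst e)) (coded_clopen (psnd e))"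
  have "orbit_closure ` X \<subseteq> insert X {Y. subshift Y \<and> Y \<subset> X}"
    using subshift_orbit_closure limit_set_subset[OF assms(1)] by blast
  then have fin: "finite (orbit_closure ` X)"
    using assms(2) unfolding quasiminimal_def by (meson finite.insertI finite_subset)
  have valid: "decidable_pred ?valid"
    by (intro decidable_pred_intros decidable_pred_valid_code computable_intros) simp_all
  have "semidecidable (\<lambda>e (y :: int \<Rightarrow> 'a). \<exists>Z\<in>orbit_closure ` X. ?halts Z e)"
    using semidecidable_halts_orbit_closure(1)[OF assms]
    by (intro semidecidable_finite_disj fin) auto
  then have pos: "semidecidable (\<lambda>e (y :: int \<Rightarrow> 'a). ?valid e \<and> ?halts X e)"
    unfolding halts_iff_orbit_closure[OF assms(1)]
    by (intro semidecidable_conj semidecidable_decidable[OF valid])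
  have "\<not> (?valid e \<and> ?halts X e) \<longleftrightarrow> \<not> ?valid e \<or> (\<forall>Z\<in>orbit_closure ` X. \<not> ?halts Z e)" for e
    unfolding halts_iff_orbit_closure[OF assms(1)] by blast
  moreover have "semidecidable (\<lambda>e (y :: int \<Rightarrow> 'a). \<forall>Z\<in>orbit_closure ` X. \<not> ?halts Z e)"
    using semidecidable_halts_orbit_closure(2)[OF assms]
    by (intro semidecidable_finite_conj fin) auto
  ultimately have neg: "semidecidable (\<lambda>e (y :: int \<Rightarrow> 'a). \<not> (?valid e \<and> ?halts X e))"
    by (simp only: semidecidable_disj semidecidable_decidable[OF decidable_pred_not[OF valid]])
  show ?thesis
    using decidable_if_semidecidable_both[OF pos neg] unfolding halting_problem_eq conj_assoc .
qed

end
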